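(* Let $G=(L\cup R,E)$ be a bipartite graph with $n$ vertices and positive edge weights such that the ratio between the maximum and minimum edge weight is $\mathrm{poly}(n)$. For every $\varepsilon>0$ there exists a distributed algorithm computing a $(1-\varepsilon)$-approximate maximum weight matching of $G$ that runs in either (a) $O\!\left(\frac{\log n}{\varepsilon^7}\right)$ rounds of communication using $O\!\left(\frac{\log^2 n}{\varepsilon}\right)$ bits of communication, or (b) $O\!\left(\frac{\log n}{\varepsilon^8}\right)$ rounds of communication using $O(\log^2 n)$ bits of communication. In the blackboard distributed model this requires a total of $O\!\left(\frac{n\log^3 n}{\varepsilon^8}\right)$ bits of communication.
   Context: A matching is a set of vertex-disjoint edges; its weight is the sum of its edge weights. A $(1-\varepsilon)$-approximate maximum weight matching has weight at least $(1-\varepsilon)$ times the maximum matching weight. Blackboard distributed model: one player per vertex of the smaller side of the bipartition, each knowing its incident weighted edges; in each round every player writes a message to a common blackboard (central coordinator) and may receive a message; messages depend only on the blackboard and private information; the output is determined from the blackboard. Complexity measures: number of rounds and bits per message (total communication = sum over all messages). *)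

theory Defs
  imports "HOL-Probability.Probability"
begin

definition bipartite_graph :: "'v set \<Rightarrow> 'v set \<Rightarrow> 'v set set \<Rightarrow> bool" where
  "bipartite_graph L R E \<longleftrightarrow>
     finite L \<and> finite R \<and> L \<inter> R = {} \<and> E \<subseteq> {{u, v} | u v. u \<in> L \<and> v \<in> R}"

definition is_matching :: "'v set set \<Rightarrow> 'v set set \<Rightarrow> bool" where
  "is_matching E M \<longleftrightarrow> M \<subseteq> E \<and> disjoint M"

definition max_matching_weight :: "'v set set \<Rightarrow> ('v set \<Rightarrow> real) \<Rightarrow> real" where
  "max_matching_weight E w = Max {sum w M | M. is_matching E M}"

definition approx_max_weight_matching ::
    "real \<Rightarrow> 'v set set \<Rightarrow> ('v set \<Rightarrow> real) \<Rightarrow> 'v set set \<Rightarrow> bool" where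
  "approx_max_weight_matching \<epsilon> E w M \<longleftrightarrow>
     is_matching E M \<and> sum w M \<ge> (1 - \<epsilon>) * max_matching_weight E w"

text \<open>Positive weights whose max/min ratio is at most \<open>n ^ k\<close>; the exponent \<open>k\<close> is a
  constant on which the hidden constants of the complexity bounds may depend.\<close>

definition poly_weights :: "nat \<Rightarrow> nat \<Rightarrow> 'v set set \<Rightarrow> ('v set \<Rightarrow> real) \<Rightarrow> bool" where
  "poly_weights k n E w \<longleftrightarrow>
     (\<forall>e\<in>E. 0 < w e) \<and> (E \<noteq> {} \<longrightarrow> Max (w ` E) / Min (w ` E) \<le> real n ^ k)"

definition smaller_side :: "'v set \<Rightarrow> 'v set \<Rightarrow> 'v set" where
  "smaller_side L R = (if card L \<le> card R then L else R)"

text \<open>A blackboard lists, round by round, the bit string written by each player. A message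
  is a bit string drawn, with private randomness, from a distribution that depends only on the
  name of the player, the private information of that player and the current blackboard.
  Memory of earlier private coins would add no power: a player can redraw them
  conditioned on its own past messages, which are on the blackboard. Likewise anything the
  coordinator could send is a function of the blackboard, which every player reads.\<close>

type_synonym 'v blackboard = "('v \<Rightarrow> bool list) list"

type_synonym 'v local_info = "('v set \<times> real) set"

record 'v protocol =
  rounds :: nat
  message :: "'v \<Rightarrow> 'v local_info \<Rightarrow> 'v blackboard \<Rightarrow> bool list pmf"
  outcome :: "'v blackboard \<Rightarrow> 'v set set"

definition incident_edges :: "'v set set \<Rightarrow> ('v set \<Rightarrow> real) \<Rightarrow> 'v \<Rightarrow> 'v local_info" where
  "incident_edges E w v = {(e, w e) | e. e \<in> E \<and> v \<in> e}"

text \<open>All players of \<open>P\<close> write simultaneously and with independent private coins.\<close>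

primrec blackboard_after ::
    "'v set \<Rightarrow> 'v protocol \<Rightarrow> ('v \<Rightarrow> 'v local_info) \<Rightarrow> nat \<Rightarrow> 'v blackboard pmf" where
  "blackboard_after P \<pi> x 0 = return_pmf []"
| "blackboard_after P \<pi> x (Suc t) =
     bind_pmf (blackboard_after P \<pi> x t) (\<lambda>b.
       map_pmf (\<lambda>m. b @ [m]) (Pi_pmf P [] (\<lambda>v. message \<pi> v (x v) b)))"

definition run ::
    "'v set \<Rightarrow> 'v set \<Rightarrow> 'v protocol \<Rightarrow> 'v set set \<Rightarrow> ('v set \<Rightarrow> real) \<Rightarrow> 'v blackboard pmf" where
  "run L R \<pi> E w = blackboard_after (smaller_side L R) \<pi> (incident_edges E w) (rounds \<pi>)"

definition total_bits :: "'v set \<Rightarrow> 'v blackboard \<Rightarrow> nat" where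
  "total_bits P b = (\<Sum>m\<leftarrow>b. \<Sum>v\<in>P. length (m v))"

text \<open>The round, message size and total communication bounds \<open>T\<close>, \<open>B\<close>, \<open>S\<close> hold on every
  run; only the quality of the output is probabilistic, with failure probability at most
  \<open>\<delta>\<close>. The protocol knows the vertex set and the parameters, but not the graph.\<close>

definition mwm_protocol ::
    "'v set \<Rightarrow> 'v set \<Rightarrow> nat \<Rightarrow> real \<Rightarrow> real \<Rightarrow> real \<Rightarrow> real \<Rightarrow> real \<Rightarrow> 'v protocol \<Rightarrow> bool" where
  "mwm_protocol L R k \<epsilon> \<delta> T B S \<pi> \<longleftrightarrow>
     real (rounds \<pi>) \<le> T \<and>
     (\<forall>E w. bipartite_graph L R E \<and> poly_weights k (card (L \<union> R)) E w \<longrightarrow>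
        measure_pmf.prob (run L R \<pi> E w)
          {b. approx_max_weight_matching \<epsilon> E w (outcome \<pi> b)} \<ge> 1 - \<delta> \<and>
        (\<forall>b \<in> set_pmf (run L R \<pi> E w).
           (\<forall>m \<in> set b. \<forall>v \<in> smaller_side L R. real (length (m v)) \<le> B) \<and>
           real (total_bits (smaller_side L R) b) \<le> S))"

end

theory Submission
  imports Defs "HOL-Real_Asymp.Real_Asymp"
begin

text \<open>The protocol is multiplicative weights combined with sampling. Every player samples its own
  edges; the blackboard determines nearly optimal dual prices of the graph reported so far.
  If that graph has no nearly optimal matching, its prices are too small to cover an optimal matching
  \<open>M\<close> of \<open>E\<close>, so edges of \<open>M\<close> of total weight at least \<open>2 * \<eta> * w M\<close> are violated. On the other hand,
  by a union bound over rounded prices, with high probability all prices that cover a fresh sample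
  violate only a small weighted fraction of the sampling distributions. Doubling the weight of the
  violated edges therefore favours the edges of \<open>M\<close>, and this can go on for only
  \<open>O(ln n / \<eta>)\<close> phases. The weighted case needs no extra logarithm: a price is informative only
  for edges of weight up to \<open>1 / \<eta>\<close> times the price, so the cost of the union bound over all weight
  classes is a geometric series, and the multiplicative weights use one learning scale per edge.\<close>

section \<open>Approximate duality by an auction\<close>

text \<open>Both bounds of the theorem come from the same protocol. For 1 / n \<le> \<epsilon> < 1
  it uses O(log n / \<epsilon>^4) rounds and O(log^2 n) bits per message, so that the exponents 7
  and 8 leave slack. The condition 1 / n \<le> \<epsilon> lets every log(1 / \<epsilon>) be absorbed
  into log n; for smaller \<epsilon> the round budget pays for one yes/no question per possible edge
  and class. Two obstacles shape the construction. The prices are computed from the very samples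
  that they cover, so they cannot be treated as fixed in advance; this forces a union bound over all
  rounded prices. And nobody knows the absolute scale of the weights, while all players have to
  react to the same prices. Hence prices are a canonical function of the reports, and every player
  calibrates the scale by an edge of its own.\<close>

lemma bipartite_edgeE:
  assumes "bipartite_graph P Q H" "e \<in> H"
  obtains u j where "e = {u, j}" "u \<in> P" "j \<in> Q" "e \<inter> P = {u}" "e \<inter> Q = {j}" "u \<noteq> j"
  using assms unfolding bipartite_graph_def by blast

lemma bipartite_edge_P:
  assumes "bipartite_graph P Q H" "e \<in> H" "u \<in> e" "u \<in> P"
  shows "e \<inter> P = {u}"
  using bipartite_edgeE[OF assms(1,2)] assms(3,4) by (metis IntI singletonD)

lemma bipartite_edge_Q:
  assumes "bipartite_graph P Q H" "e \<in> H" "u \<in> e" "u \<in> Q"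
  shows "e \<inter> Q = {u}"
  using bipartite_edgeE[OF assms(1,2)] assms(3,4) by (metis IntI singletonD)

lemma bipartite_edge_subset:
  assumes "bipartite_graph P Q H" "e \<in> H"
  shows "e \<subseteq> P \<union> Q" "finite e"
  by (rule bipartite_edgeE[OF assms]; auto)+

lemma bipartite_graph_finite:
  assumes "bipartite_graph P Q H" shows "finite H"
proof -
  have "H \<subseteq> Pow (P \<union> Q)" "finite (Pow (P \<union> Q))"
    using assms by (auto simp: bipartite_graph_def)
  then show ?thesis by (rule finite_subset)
qed

lemma finite_maximizer:
  fixes f :: "'b \<Rightarrow> 'c :: linorder"
  assumes "finite F" "F \<noteq> {}"
  obtains b where "b \<in> F" "\<And>x. x \<in> F \<Longrightarrow> f x \<le> f b"
proof -
  have "Max (f ` F) \<in> f ` F" using assms by (intro Max_in) auto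
  then obtain b where b: "b \<in> F" "Max (f ` F) = f b" by auto
  have "f x \<le> f b" if "x \<in> F" for x
    using Max_ge[of "f ` F" "f x"] assms that b by simp
  then show thesis using that b by blast
qed

text \<open>The auction algorithm with bid increment \<delta>. Termination is replaced by
  extremality: among all states satisfying the auction invariant take one of largest total price; a
  player that still wanted to bid would lead to a larger one. Unmatched vertices end up with dual
  value 0 and each matched edge overpays by exactly \<delta>, which gives the last bound.\<close>

lemma auction_dual:
  fixes w :: "'v set \<Rightarrow> real"
  assumes H: "bipartite_graph P Q H" and \<delta>: "0 < \<delta>" and w: "\<And>e. e \<in> H \<Longrightarrow> 0 \<le> w e"
  obtains M y where "is_matching H M" "\<And>v. 0 \<le> y v" "\<And>e. e \<in> H \<Longrightarrow> w e \<le> sum y e"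
    "sum y (P \<union> Q) \<le> sum w M + \<delta> * real (card M)"
proof -
  have fin: "finite P" "finite Q" "P \<inter> Q = {}" "finite H"
    using H bipartite_graph_finite[OF H] by (auto simp: bipartite_graph_def)
  define pr :: "('v \<Rightarrow> nat) \<Rightarrow> 'v set \<Rightarrow> real" where "pr p e = real (sum p (e \<inter> Q))" for p e
  \<comment> \<open>The invariant: priced vertices of Q are matched, a matched player loses at most
    \<delta>, and its edge is within \<delta> of its best edge at the current prices.\<close>
  define S where "S = (\<lambda>(M, p). is_matching H M \<and> (\<forall>j\<in>Q. p j > 0 \<longrightarrow> j \<in> \<Union>M) \<and>
    (\<forall>e\<in>M. \<delta> * pr p e \<le> w e + \<delta> \<and>
      (\<forall>f\<in>H. e \<inter> f \<inter> P \<noteq> {} \<longrightarrow> w f - \<delta> * pr p f \<le> w e - \<delta> * pr p e + \<delta>)))"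
  define W where "W = Max (insert 0 (w ` H))"
  have W: "w e \<le> W" if "e \<in> H" for e using fin that by (auto simp: W_def)
  \<comment> \<open>A matched player loses at most \<delta>, so no price unit count exceeds N. This
    makes a state of maximal total price exist.\<close>
  define N where "N = nat \<lceil>W / \<delta> + 1\<rceil>"
  have init: "S ({}, \<lambda>_. 0)" by (auto simp: S_def is_matching_def)
  have bound: "sum (snd s) Q \<le> card Q * N" if "S s" for s
  proof -
    obtain M p where s: "s = (M, p)" by (cases s)
    have "p j \<le> N" if j: "j \<in> Q" for j
    proof (cases "p j > 0")
      case True
      then obtain e where e: "e \<in> M" "j \<in> e" using \<open>S s\<close> j by (auto simp: S_def s)
      have eH: "e \<in> H" using e \<open>S s\<close> by (auto simp: S_def s is_matching_def)
      have "e \<inter> Q = {j}" using bipartite_edge_Q[OF H eH] e j by blast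
      then have "pr p e = p j" by (simp add: pr_def)
      then have "\<delta> * p j \<le> w e + \<delta>" using \<open>S s\<close> e by (auto simp: S_def s)
      also have "\<dots> \<le> W + \<delta>" using W[OF eH] by simp
      finally have "real (p j) \<le> W / \<delta> + 1" using \<delta> by (simp add: field_simps)
      then show ?thesis unfolding N_def by linarith
    qed simp
    then show ?thesis using sum_bounded_above[of Q p N] s by simp
  qed
  have "\<exists>s. S s \<and> (\<forall>s'. S s' \<longrightarrow> sum (snd s') Q \<le> sum (snd s) Q)"
    by (rule ex_has_greatest_nat[where P=S and k="({}, \<lambda>_. 0)" and b="Suc (card Q * N)"])
       (use init bound in \<open>auto simp: less_Suc_eq_le\<close>)
  then obtain s where s: "S s" and smax: "\<And>s'. S s' \<Longrightarrow> sum (snd s') Q \<le> sum (snd s) Q"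
    by auto
  obtain M p where sM: "s = (M, p)" by (cases s)
  have M: "is_matching H M" and pM: "\<And>j. j \<in> Q \<Longrightarrow> p j > 0 \<Longrightarrow> j \<in> \<Union>M"
    and happy0: "\<And>e. e \<in> M \<Longrightarrow> \<delta> * pr p e \<le> w e + \<delta>"
    and happy: "\<And>e f. e \<in> M \<Longrightarrow> f \<in> H \<Longrightarrow> e \<inter> f \<inter> P \<noteq> {} \<Longrightarrow>
      w f - \<delta> * pr p f \<le> w e - \<delta> * pr p e + \<delta>"
    using s by (auto simp: S_def sM)
  have MH: "M \<subseteq> H" and Md: "disjoint M" using M by (auto simp: is_matching_def)
  \<comment> \<open>Otherwise the unmatched player \<open>i\<close> bids one unit on its best edge
    \<open>b\<close>, displacing the edge at \<open>j\<close> if there is one. The invariant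
    survives and the total price grows by one.\<close>
  have unmatched: "w e \<le> \<delta> * pr p e" if e: "e \<in> H" "e \<inter> P \<inter> \<Union>M = {}" for e
  proof (rule ccontr)
    assume neg: "\<not> ?thesis"
    obtain i where i: "e \<inter> P = {i}" by (rule bipartite_edgeE[OF H e(1)]) blast
    define F where "F = {f \<in> H. i \<in> f}"
    have F: "finite F" "F \<noteq> {}" "e \<in> F" using e i fin by (auto simp: F_def)
    obtain b where b: "b \<in> F" "\<And>f. f \<in> F \<Longrightarrow> w f - \<delta> * pr p f \<le> w b - \<delta> * pr p b"
      by (rule finite_maximizer[OF F(1,2), of "\<lambda>f. w f - \<delta> * pr p f"]) blast
    have bpos: "w b - \<delta> * pr p b > 0" using b(2)[OF F(3)] neg by simp
    have bH: "b \<in> H" "i \<in> b" using b by (auto simp: F_def)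
    have iP: "i \<in> P" "i \<in> e" using i by auto
    have bP: "b \<inter> P = {i}" using bipartite_edge_P[OF H bH] iP by blast
    obtain j where j: "b = {i, j}" "j \<in> Q" "b \<inter> Q = {j}" "i \<noteq> j"
      by (rule bipartite_edgeE[OF H bH(1)]) (use bP in blast)
    have iM: "i \<notin> \<Union>M" using e i iP by blast
    define M' where "M' = insert b {f \<in> M. j \<notin> f}"
    define p' where "p' = p(j := Suc (p j))"
    have pr': "pr p' f = pr p f + (if j \<in> f then 1 else 0)" if f: "f \<in> H" for f
    proof -
      obtain a where a: "f \<inter> Q = {a}" by (rule bipartite_edgeE[OF H f]) blast
      then have "a = j \<longleftrightarrow> j \<in> f" using j by auto
      then show ?thesis using a by (auto simp: pr_def p'_def)
    qed
    have "disjoint M'" unfolding M'_def disjoint_def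
      using Md iM j by (auto simp: disjoint_def)
    moreover have "M' \<subseteq> H" using MH bH by (auto simp: M'_def)
    moreover have "j' \<in> \<Union>M'" if j': "j' \<in> Q" "p' j' > 0" for j'
    proof (cases "j' = j")
      case False
      then have "p j' > 0" using that by (simp add: p'_def)
      then obtain f where f: "f \<in> M" "j' \<in> f" using pM[OF j'(1)] by blast
      then have "f \<inter> Q = {j'}" using bipartite_edge_Q[OF H _ f(2)] MH f(1) that by blast
      then have "j \<notin> f" using j False by auto
      then show ?thesis using f by (auto simp: M'_def)
    qed (use j in \<open>auto simp: M'_def\<close>)
    moreover have "\<delta> * pr p' f \<le> w f + \<delta> \<and> (\<forall>h\<in>H. f \<inter> h \<inter> P \<noteq> {} \<longrightarrow>
        w h - \<delta> * pr p' h \<le> w f - \<delta> * pr p' f + \<delta>)" if f: "f \<in> M'" for f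
    proof (cases "f = b")
      case True
      have "pr p' b = pr p b + 1" using pr'[OF bH(1)] j by simp
      moreover have "w h - \<delta> * pr p' h \<le> w b - \<delta> * pr p b" if "h \<in> H" "b \<inter> h \<inter> P \<noteq> {}" for h
      proof -
        have "h \<in> F" using that bP by (auto simp: F_def)
        then show ?thesis using b(2)[of h] pr'[OF that(1)] \<delta> by (auto simp: algebra_simps)
      qed
      ultimately show ?thesis using True bpos by (simp add: algebra_simps)
    next
      case False
      then have fM: "f \<in> M" "j \<notin> f" using f by (auto simp: M'_def)
      then have "pr p' f = pr p f" using pr' MH by auto
      moreover have "w h - \<delta> * pr p' h \<le> w h - \<delta> * pr p h" if "h \<in> H" for h
        using pr'[OF that] \<delta> by (auto simp: algebra_simps)
      ultimately show ?thesis using happy0[OF fM(1)] happy[OF fM(1)] by fastforce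
    qed
    ultimately have "S (M', p')" by (auto simp: S_def is_matching_def)
    from smax[OF this] have "sum p' Q \<le> sum p Q" by (simp add: sM)
    moreover have "sum p' Q = sum p Q + 1"
      using fin j by (simp add: p'_def sum.remove[of Q j])
    ultimately show False by simp
  qed
  have Mfin: "finite M" using MH fin finite_subset by blast
  \<comment> \<open>A matched player gets its net value plus \<delta>. The inner sum has at most one
    term because M is a matching, and is 0 at unmatched vertices.\<close>
  define y where "y v = (if v \<in> Q then \<delta> * p v
    else if v \<in> P then (\<Sum>e\<in>{e\<in>M. v \<in> e}. w e - \<delta> * pr p e + \<delta>) else 0)" for v
  have yP: "y v = w e - \<delta> * pr p e + \<delta>" if "e \<in> M" "v \<in> e" "v \<in> P" for e v
  proof -
    have "{e\<in>M. v \<in> e} = {e}" using that Md by (auto simp: disjoint_def)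
    moreover have "v \<notin> Q" using that fin by auto
    ultimately show ?thesis using that by (simp add: y_def)
  qed
  have y_pr: "sum y e = y u + \<delta> * pr p e" if eu: "e \<in> H" "u \<in> e" "u \<in> P" for e u
  proof -
    obtain a j where aj: "e = {a, j}" "a \<in> P" "j \<in> Q" "e \<inter> P = {a}" "e \<inter> Q = {j}" "a \<noteq> j"
      by (rule bipartite_edgeE[OF H eu(1)]) blast
    then have "a = u" using that by auto
    then show ?thesis using aj by (simp add: y_def pr_def)
  qed
  have y0: "0 \<le> y v" for v
  proof -
    have "0 \<le> w e - \<delta> * pr p e + \<delta>" if "e \<in> M" for e
      using happy0[OF that] by simp
    then show ?thesis using \<delta> by (auto simp: y_def intro!: sum_nonneg)
  qed
  moreover have "w e \<le> sum y e" if e: "e \<in> H" for e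
  proof -
    obtain u where u: "u \<in> e" "u \<in> P" "e \<inter> P = {u}" by (rule bipartite_edgeE[OF H e]) auto
    show ?thesis
    proof (cases "u \<in> \<Union>M")
      case True
      then obtain f where f: "f \<in> M" "u \<in> f" by auto
      have "w e - \<delta> * pr p e \<le> w f - \<delta> * pr p f + \<delta>" using happy[OF f(1) e] f u by auto
      then show ?thesis using y_pr[OF e u(1,2)] yP[OF f u(2)] by simp
    next
      case False
      then show ?thesis using unmatched[OF e] y_pr[OF e u(1,2)] y0[of u] u by auto
    qed
  qed
  moreover have "sum y (P \<union> Q) \<le> sum w M + \<delta> * real (card M)"
  proof -
    have zero: "y v = 0" if "v \<in> P \<union> Q - \<Union>M" for v
    proof (cases "v \<in> Q")
      case True
      then have "p v = 0" using pM that by blast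
      then show ?thesis using True by (simp add: y_def)
    next
      case False
      then have "{e\<in>M. v \<in> e} = {}" using that by auto
      then have "(\<Sum>e\<in>{e\<in>M. v \<in> e}. w e - \<delta> * pr p e + \<delta>) = 0" by (metis sum.empty)
      then show ?thesis using False by (simp add: y_def)
    qed
    have sub: "\<Union>M \<subseteq> P \<union> Q" "\<forall>e\<in>M. finite e"
      using bipartite_edge_subset[OF H] MH by blast+
    have "sum y (P \<union> Q) = sum y (\<Union>M)"
      using fin sub zero by (intro sum.mono_neutral_right) auto
    also have "\<dots> = (\<Sum>e\<in>M. sum y e)"
      using sum.Union_disjoint[of M y] sub Md by (auto simp: disjoint_def)
    also have "\<dots> = (\<Sum>e\<in>M. w e + \<delta>)"
    proof (rule sum.cong)
      fix e assume e: "e \<in> M"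
      have "e \<in> H" using MH e by auto
      then obtain u where u: "u \<in> e" "u \<in> P" by (rule bipartite_edgeE[OF H]) auto
      show "sum y e = w e + \<delta>" using y_pr[of e u] yP[OF e u] MH e u by auto
    qed simp
    finally show ?thesis by (simp add: sum.distrib algebra_simps)
  qed
  ultimately show thesis using that M by blast
qed

section \<open>Sampling weights of a single player\<close>

text \<open>This is the projection onto total mass at most 1 for the weighted entropy \<Sum>
  \<omega> e * m e * ln (m e): \<open>h\<close> is the Lagrange multiplier, and dividing it by
  \<open>\<omega> e\<close> gives each edge its own learning scale. \<open>c e\<close> counts past
  violations and \<open>\<pi>\<close> is the initial mass.\<close>

definition sampling_mass :: "real \<Rightarrow> ('e \<Rightarrow> real) \<Rightarrow> ('e \<Rightarrow> nat) \<Rightarrow> real \<Rightarrow> 'e \<Rightarrow> real" where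
  "sampling_mass \<pi> \<omega> c h e = \<pi> * 2 ^ c e * exp (- h / \<omega> e)"

definition level :: "real \<Rightarrow> ('e \<Rightarrow> real) \<Rightarrow> 'e set \<Rightarrow> ('e \<Rightarrow> nat) \<Rightarrow> real" where
  "level \<pi> \<omega> A c = (if sum (sampling_mass \<pi> \<omega> c 0) A \<le> 1 then 0
     else SOME h. 0 \<le> h \<and> sum (sampling_mass \<pi> \<omega> c h) A = 1)"

text \<open>Raising \<open>h\<close> lowers the total mass continuously to 0, so the intermediate
  value theorem yields a level of mass exactly 1. The third claim is complementary slackness for the
  multiplier.\<close>

lemma level_properties:
  assumes A: "finite A" and \<omega>: "\<And>e. e \<in> A \<Longrightarrow> 0 < \<omega> e"
  shows "0 \<le> level \<pi> \<omega> A c" "sum (sampling_mass \<pi> \<omega> c (level \<pi> \<omega> A c)) A \<le> 1"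
    "level \<pi> \<omega> A c = 0 \<or> sum (sampling_mass \<pi> \<omega> c (level \<pi> \<omega> A c)) A = 1"
proof -
  let ?f = "\<lambda>h. sum (sampling_mass \<pi> \<omega> c h) A"
  have "\<exists>h\<ge>0. ?f h = 1" if "?f 0 > 1"
  proof -
    have "((\<lambda>h. \<pi> * 2 ^ c e * exp (- h / \<omega> e)) \<longlongrightarrow> 0) at_top" if "e \<in> A" for e
      using \<omega>[OF that] by real_asymp
    then have "(?f \<longlongrightarrow> (\<Sum>e\<in>A. 0)) at_top"
      unfolding sampling_mass_def by (intro tendsto_sum)
    then have "eventually (\<lambda>h. ?f h < 1) at_top"
      by (intro order_tendstoD(2)) auto
    then have "eventually (\<lambda>h. ?f h < 1 \<and> h \<ge> 0) at_top"
      using eventually_ge_at_top[of 0] by eventually_elim simp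
    then obtain l where l: "?f l < 1" "l \<ge> 0" by (auto simp: eventually_at_top_linorder)
    have "continuous_on {0..l} ?f"
      unfolding sampling_mass_def using \<omega> by (intro continuous_intros) fastforce
    then have "\<exists>x\<ge>0. x \<le> l \<and> ?f x = 1"
      using l that by (intro IVT2') auto
    then show ?thesis by blast
  qed
  then have *: "0 \<le> (SOME h. 0 \<le> h \<and> ?f h = 1) \<and> ?f (SOME h. 0 \<le> h \<and> ?f h = 1) = 1" if "?f 0 > 1"
    using that by (metis (mono_tags, lifting) someI_ex)
  have "0 \<le> level \<pi> \<omega> A c \<and> ?f (level \<pi> \<omega> A c) \<le> 1 \<and>
      (level \<pi> \<omega> A c = 0 \<or> ?f (level \<pi> \<omega> A c) = 1)"
  proof (cases "?f 0 \<le> 1")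
    case False
    then have "level \<pi> \<omega> A c = (SOME h. 0 \<le> h \<and> ?f h = 1)" by (simp only: level_def if_False)
    then show ?thesis using * False by (metis not_le order_refl)
  qed (simp add: level_def)
  then show "0 \<le> level \<pi> \<omega> A c" "?f (level \<pi> \<omega> A c) \<le> 1"
    "level \<pi> \<omega> A c = 0 \<or> ?f (level \<pi> \<omega> A c) = 1" by auto
qed

text \<open>Multi-scale multiplicative weights. The potential \<open>\<Sum>e. \<omega> e * m e\<close> grows by at most the
  sampled violation, and raising the level by \<open>\<Delta>\<close> lowers it by at least \<open>\<Delta>\<close>, so that the level
  stays below the initial potential plus the total sampled violation.\<close>

lemma multiscale_weights:
  fixes viol :: "nat \<Rightarrow> 'e \<Rightarrow> bool" and \<pi> :: real
  assumes A: "finite A" and \<omega>: "\<And>e. e \<in> A \<Longrightarrow> 0 < \<omega> e" and \<pi>: "0 < \<pi>" "\<pi> * card A \<le> 1"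
    and c0: "\<And>e. c 0 e = 0" and cS: "\<And>t e. e \<in> A \<Longrightarrow> c (Suc t) e = c t e + of_bool (viol t e)"
    and e: "e \<in> A"
  defines "m \<equiv> \<lambda>t. sampling_mass \<pi> \<omega> (c t) (level \<pi> \<omega> A (c t))"
  shows "ln 2 * \<omega> e * real (c T e) \<le> \<omega> e * ln (1 / \<pi>) + \<pi> * sum \<omega> A +
    (\<Sum>t<T. \<Sum>e\<in>{e\<in>A. viol t e}. m t e * \<omega> e)"
proof -
  let ?l = "\<lambda>t. level \<pi> \<omega> A (c t)"
  let ?\<Psi> = "\<lambda>t. \<Sum>e\<in>A. \<omega> e * m t e"
  have step: "?\<Psi> (Suc t) + ?l (Suc t) \<le> ?\<Psi> t + ?l t + (\<Sum>e\<in>{e\<in>A. viol t e}. m t e * \<omega> e)" for t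
  proof -
    let ?\<Delta> = "?l (Suc t) - ?l t"
    have "\<omega> e * m (Suc t) e \<le> \<omega> e * m t e + of_bool (viol t e) * (m t e * \<omega> e) - ?\<Delta> * m (Suc t) e"
      if eA: "e \<in> A" for e
    proof -
      define x where "x = ?\<Delta> / \<omega> e"
      define k where "k = \<pi> * 2 ^ c (Suc t) e * exp (- ?l t / \<omega> e)"
      have k: "0 \<le> k" using \<pi> by (simp add: k_def)
      have mS: "m (Suc t) e = k * exp (- x)"
        by (simp add: m_def sampling_mass_def k_def x_def diff_divide_distrib flip: exp_add)
      have mk: "k = m t e * (1 + of_bool (viol t e))"
        by (simp add: k_def m_def sampling_mass_def cS[OF eA])
      \<comment> \<open>The inequality (1 + x) * exp (- x) \<le> 1 holds for either sign of
        \<open>x\<close>, so rising and falling levels need no distinction. The factor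
        \<open>\<omega> e\<close> in the potential cancels the scale in the exponent, so that every
        edge is charged with the same \<Delta>.\<close>
      have "1 + x \<le> exp x" by (rule exp_ge_add_one_self)
      then have "(1 + x) * exp (- x) \<le> exp x * exp (- x)" by (intro mult_right_mono) auto
      then have "(1 + x) * exp (- x) \<le> 1" by (simp flip: exp_add)
      then have "k * ((1 + x) * exp (- x)) \<le> k" using k mult_left_mono by fastforce
      then have "\<omega> e * (k * ((1 + x) * exp (- x))) \<le> \<omega> e * k" using \<omega>[OF eA] by simp
      moreover have \<Delta>: "?\<Delta> = \<omega> e * x" using \<omega>[OF eA] by (simp add: x_def)
      have "\<omega> e * m (Suc t) e + ?\<Delta> * m (Suc t) e = \<omega> e * (k * ((1 + x) * exp (- x)))"
        unfolding \<Delta> mS by (simp only: distrib_right distrib_left mult_1_left mult_ac)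
      ultimately have "\<omega> e * m (Suc t) e + ?\<Delta> * m (Suc t) e \<le> \<omega> e * k" by simp
      then show ?thesis using mk by (simp add: algebra_simps)
    qed
    then have "?\<Psi> (Suc t) \<le> (\<Sum>e\<in>A. \<omega> e * m t e + of_bool (viol t e) * (m t e * \<omega> e) - ?\<Delta> * m (Suc t) e)"
      by (rule sum_mono)
    also have "\<dots> = ?\<Psi> t + (\<Sum>e\<in>A. of_bool (viol t e) * (m t e * \<omega> e)) - ?\<Delta> * sum (m (Suc t)) A"
      by (simp add: sum.distrib sum_subtractf sum_distrib_left)
    also have "(\<Sum>e\<in>A. of_bool (viol t e) * (m t e * \<omega> e)) = (\<Sum>e\<in>{e\<in>A. viol t e}. m t e * \<omega> e)"
      using A by (simp add: sum.inter_filter of_bool_def if_distrib cong: if_cong)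
        (intro sum.cong; auto)
    finally have 1: "?\<Psi> (Suc t) \<le> ?\<Psi> t + (\<Sum>e\<in>{e\<in>A. viol t e}. m t e * \<omega> e) - ?\<Delta> * sum (m (Suc t)) A" .
    \<comment> \<open>Either the new mass is 1, or the new level is 0; in the latter case \<Delta>
      \<le> 0 and the mass is at most 1.\<close>
    have "?\<Delta> \<le> ?\<Delta> * sum (m (Suc t)) A"
    proof (cases "sum (m (Suc t)) A = 1")
      case False
      then have "?l (Suc t) = 0" using level_properties(3)[of A \<omega> \<pi> "c (Suc t)"] A \<omega> by (auto simp: m_def)
      then have "?\<Delta> \<le> 0" using level_properties(1)[of A \<omega> \<pi> "c t"] A \<omega> by auto
      moreover have "sum (m (Suc t)) A \<le> 1"
        using level_properties(2)[of A \<omega> \<pi> "c (Suc t)"] A \<omega> by (auto simp: m_def)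
      ultimately show ?thesis by (metis mult_left_mono_neg mult.right_neutral)
    qed simp
    with 1 show ?thesis by simp
  qed
  have "?\<Psi> T + ?l T \<le> ?\<Psi> 0 + ?l 0 + (\<Sum>t<T. \<Sum>e\<in>{e\<in>A. viol t e}. m t e * \<omega> e)"
  proof (induction T)
    case (Suc T)
    then show ?case using step[of T] by simp
  qed simp
  moreover have "0 \<le> ?\<Psi> T"
    using \<pi> \<omega> by (intro sum_nonneg) (auto simp: m_def sampling_mass_def less_imp_le)
  moreover have l0: "?l 0 = 0"
    using \<pi> by (simp add: level_def sampling_mass_def c0 mult.commute)
  moreover have "?\<Psi> 0 = \<pi> * sum \<omega> A"
    using l0 by (simp add: m_def sampling_mass_def c0 sum_distrib_left mult.commute)
  ultimately have lT: "?l T \<le> \<pi> * sum \<omega> A + (\<Sum>t<T. \<Sum>e\<in>{e\<in>A. viol t e}. m t e * \<omega> e)"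
    by simp
  have mpos: "0 < m T e" for e using \<pi> by (simp add: m_def sampling_mass_def)
  \<comment> \<open>A single mass is at most 1; its logarithm turns the bound on the level into a
    bound on the number of violations of \<open>e\<close>.\<close>
  have "m T e \<le> sum (m T) A" using A e mpos by (intro member_le_sum) (auto simp: less_imp_le)
  also have "\<dots> \<le> 1" using level_properties(2)[of A \<omega> \<pi> "c T"] A \<omega> by (auto simp: m_def)
  finally have "ln (m T e) \<le> 0" using mpos[of e] by simp
  moreover have "ln (m T e) = ln \<pi> + real (c T e) * ln 2 - ?l T / \<omega> e"
    using \<pi> by (simp add: m_def sampling_mass_def ln_mult ln_realpow)
  ultimately have "real (c T e) * ln 2 \<le> ln (1 / \<pi>) + ?l T / \<omega> e"
    using \<pi> by (simp add: ln_div)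
  then have "\<omega> e * (real (c T e) * ln 2) \<le> \<omega> e * (ln (1 / \<pi>) + ?l T / \<omega> e)"
    using \<omega>[OF e] by (intro mult_left_mono) auto
  then show ?thesis using lT \<omega>[OF e] by (simp add: algebra_simps)
qed

section \<open>Sampling distributions and repeated independent trials\<close>

lemma exists_pmf_ge:
  fixes m :: "'e \<Rightarrow> real"
  assumes A: "finite A" "A \<noteq> {}" and m: "\<And>e. e \<in> A \<Longrightarrow> 0 \<le> m e" "sum m A \<le> 1"
  shows "\<exists>p. set_pmf p \<subseteq> A \<and> (\<forall>e\<in>A. m e \<le> pmf p e)"
proof -
  obtain a where a: "a \<in> A" using A by auto
  \<comment> \<open>The masses may sum to less than 1; the remainder goes to an arbitrary edge,
    which preserves the lower bounds.\<close>
  define f where "f e = (if e \<in> A then m e + (if e = a then 1 - sum m A else 0) else 0)" for e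
  have f0: "0 \<le> f e" for e using m by (auto simp: f_def)
  have "sum f A = (\<Sum>e\<in>A. m e + (if e = a then 1 - sum m A else 0))"
    by (intro sum.cong) (auto simp: f_def)
  also have "\<dots> = 1" using A a by (simp add: sum.distrib)
  finally have sf: "sum f A = 1" .
  have "(\<integral>\<^sup>+e. ennreal (f e) \<partial>count_space UNIV) = (\<Sum>e\<in>A. ennreal (f e))"
    using A by (intro nn_integral_count_space') (auto simp: f_def)
  also have "\<dots> = 1" using sf f0 by (simp add: sum_ennreal)
  finally have int: "(\<integral>\<^sup>+e. ennreal (f e) \<partial>count_space UNIV) = 1" .
  have "pmf (embed_pmf f) e = f e" for e by (intro pmf_embed_pmf f0 int)
  moreover have "set_pmf (embed_pmf f) = {e. f e \<noteq> 0}" by (intro set_embed_pmf f0 int)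
  ultimately show ?thesis using m by (intro exI[of _ "embed_pmf f"]) (auto simp: f_def)
qed

text \<open>One link of a chain: the event can survive a step only if it held before
  (\<open>A\<close>), and each step costs a factor \<open>r\<close>. It serves both for the samples
  within a message and for the rounds within a phase.\<close>

lemma prob_bind_pmf_le:
  assumes r: "0 \<le> r"
    and A: "\<And>x. x \<in> set_pmf p \<Longrightarrow> x \<in> A \<Longrightarrow> measure_pmf.prob (f x) X \<le> r"
    and not_A: "\<And>x. x \<in> set_pmf p \<Longrightarrow> x \<notin> A \<Longrightarrow> measure_pmf.prob (f x) X = 0"
  shows "measure_pmf.prob (bind_pmf p f) X \<le> r * measure_pmf.prob p A"
proof -
  have "emeasure (bind_pmf p f) X = (\<integral>\<^sup>+x. emeasure (f x) X \<partial>p)" by simp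
  also have "\<dots> \<le> (\<integral>\<^sup>+x. ennreal r * indicator A x \<partial>p)"
  proof (rule nn_integral_mono_AE, unfold AE_measure_pmf_iff, rule ballI)
    fix x assume x: "x \<in> set_pmf p"
    show "emeasure (f x) X \<le> ennreal r * indicator A x"
      using A[OF x] not_A[OF x] r
      by (cases "x \<in> A") (auto simp: measure_pmf.emeasure_eq_measure ennreal_leI)
  qed
  also have "\<dots> = ennreal r * emeasure p A" by (simp add: nn_integral_cmult)
  also have "\<dots> = ennreal (r * measure_pmf.prob p A)"
    using r by (simp add: measure_pmf.emeasure_eq_measure ennreal_mult)
  finally show ?thesis
    using r by (simp add: measure_pmf.emeasure_eq_measure)
qed

lemma prob_replicate_pmf_subset_le:
  "measure_pmf.prob (replicate_pmf r p) {es. set es \<subseteq> B} \<le> measure_pmf.prob p B ^ r"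
proof (induction r)
  case (Suc r)
  let ?X = "{es. set es \<subseteq> B}"
  have *: "replicate_pmf (Suc r) p = bind_pmf p (\<lambda>x. map_pmf (\<lambda>xs. x # xs) (replicate_pmf r p))"
    by (simp add: map_pmf_def)
  have "measure_pmf.prob (replicate_pmf (Suc r) p) ?X \<le> measure_pmf.prob p B ^ r * measure_pmf.prob p B"
    unfolding * using Suc
    by (intro prob_bind_pmf_le) (auto simp: vimage_def)
  then show ?case by (simp add: mult.commute)
qed simp

section \<open>Price levels\<close>

text \<open>Induction on the largest exponent \<open>b\<close>: the other exponents are integers at
  most \<open>b - 1\<close>, so they contribute at most (1 + \<eta>)^b / \<eta>. Gaps in
  \<open>A\<close> do no harm.\<close>

lemma sum_powr_geometric:
  fixes A :: "int set" and \<eta> x :: real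
  assumes \<eta>: "0 < \<eta>" and A: "finite A" "\<And>a. a \<in> A \<Longrightarrow> (1 + \<eta>) powr a \<le> x" and x: "0 \<le> x"
  shows "(\<Sum>a\<in>A. (1 + \<eta>) powr a) \<le> x * (1 + \<eta>) / \<eta>"
  using A x
proof (induction A arbitrary: x rule: finite_linorder_max_induct)
  case empty
  then show ?case using \<eta> by simp
next
  case (insert b A)
  have "(\<Sum>a\<in>A. (1 + \<eta>) powr a) \<le> (1 + \<eta>) powr (b - 1) * (1 + \<eta>) / \<eta>"
    using insert.hyps \<eta> by (intro insert.IH) (auto intro!: powr_mono simp: less_le)
  also have "(1 + \<eta>) powr (b - 1) * (1 + \<eta>) = (1 + \<eta>) powr b"
    using \<eta> by (simp add: powr_diff)
  finally have "(\<Sum>a\<in>insert b A. (1 + \<eta>) powr a) \<le> (1 + \<eta>) powr b * (1 + \<eta>) / \<eta>"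
    using insert.hyps \<eta> by (subst sum.insert) (auto simp: field_simps)
  also have "\<dots> \<le> x * (1 + \<eta>) / \<eta>"
    using insert.prems \<eta> by (intro divide_right_mono mult_right_mono) auto
  finally show ?case .
qed

text \<open>Prices rounded to multiples of \<open>\<eta>\<close> times the weight \<open>(1 + \<eta>) powr a\<close> of a class of
  edges, so that only prices above \<open>\<eta> * (1 + \<eta>) powr a\<close> carry information.\<close>

definition price_level :: "real \<Rightarrow> nat \<Rightarrow> ('v \<Rightarrow> real) \<Rightarrow> int \<Rightarrow> 'v \<Rightarrow> nat" where
  "price_level \<eta> Z y a v = min Z (max 1 (nat \<lceil>y v / (\<eta> * (1 + \<eta>) powr a)\<rceil>))"

text \<open>In units of the class weight, a level z stands for the price \<eta> * z. Covering is
  then a comparison with 1 that no longer mentions the class.\<close>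

definition level_covers :: "real \<Rightarrow> ('v \<Rightarrow> nat) \<Rightarrow> 'v set \<Rightarrow> bool" where
  "level_covers \<eta> z e \<longleftrightarrow> 1 \<le> \<eta> * real (sum z e)"

lemma price_level_bounds:
  assumes "1 \<le> Z" shows "price_level \<eta> Z y a v \<in> {1..Z}"
  using assms by (auto simp: price_level_def)

lemma price_level_covers:
  assumes \<eta>: "0 < \<eta>" "1 \<le> \<eta> * Z" and y: "\<And>v. 0 \<le> y v" and e: "finite e"
    and cov: "(1 + \<eta>) powr a \<le> sum y e"
  shows "level_covers \<eta> (price_level \<eta> Z y a) e"
\<comment> \<open>A single endpoint at the cap Z already covers the edge since 1 \<le> \<eta> * Z.
  Without the cap, levels are prices rounded up, which preserves covering.\<close>
proof (cases "\<exists>v\<in>e. price_level \<eta> Z y a v = Z")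
  case True
  then obtain v where v: "v \<in> e" "price_level \<eta> Z y a v = Z" by auto
  have "Z \<le> sum (price_level \<eta> Z y a) e" using member_le_sum[of v e "price_level \<eta> Z y a"] v e by simp
  then have "\<eta> * Z \<le> \<eta> * real (sum (price_level \<eta> Z y a) e)" using \<eta> by (intro mult_left_mono) linarith+
  then show ?thesis using \<eta> unfolding level_covers_def by linarith
next
  case False
  let ?g = "(1 + \<eta>) powr a"
  have "y v / (\<eta> * ?g) \<le> real (price_level \<eta> Z y a v)" if "v \<in> e" for v
  proof -
    have "price_level \<eta> Z y a v = max 1 (nat \<lceil>y v / (\<eta> * ?g)\<rceil>)"
      using False that by (auto simp: price_level_def min_def split: if_splits)
    then show ?thesis by linarith
  qed
  then have "(\<Sum>v\<in>e. y v / (\<eta> * ?g)) \<le> real (sum (price_level \<eta> Z y a) e)"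
    by (subst of_nat_sum) (rule sum_mono)
  then have "sum y e / (\<eta> * ?g) \<le> real (sum (price_level \<eta> Z y a) e)"
    by (simp add: sum_divide_distrib)
  then have "sum y e / ?g \<le> \<eta> * real (sum (price_level \<eta> Z y a) e)"
    using \<eta> by (simp add: field_simps)
  moreover have "1 \<le> sum y e / ?g" using cov \<eta> by (simp add: field_simps)
  ultimately show ?thesis by (simp add: level_covers_def)
qed

lemma price_level_le:
  assumes "0 < \<eta>" "0 \<le> y v"
  shows "real (price_level \<eta> Z y a v) \<le> y v / (\<eta> * (1 + \<eta>) powr a) + 1"
proof -
  have "0 \<le> y v / (\<eta> * (1 + \<eta>) powr a)" using assms by simp
  then show ?thesis unfolding price_level_def by linarith
qed

text \<open>Rounding adds at most one level, worth \<eta>, per endpoint. This is the origin of the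
  slack 2 * \<eta> in the notion of violation.\<close>

lemma price_level_not_covers:
  assumes \<eta>: "0 < \<eta>" and y: "\<And>v. 0 \<le> y v" and e: "card e = 2"
    and viol: "sum y e < (1 - 2 * \<eta>) * (1 + \<eta>) powr a"
  shows "\<not> level_covers \<eta> (price_level \<eta> Z y a) e"
proof -
  let ?g = "(1 + \<eta>) powr a"
  have "real (sum (price_level \<eta> Z y a) e) \<le> (\<Sum>v\<in>e. y v / (\<eta> * ?g) + 1)"
    by (subst of_nat_sum) (intro sum_mono price_level_le \<eta> y)
  also have "\<dots> = sum y e / (\<eta> * ?g) + 2" using e by (simp add: sum.distrib sum_divide_distrib)
  finally have "\<eta> * real (sum (price_level \<eta> Z y a) e) \<le> sum y e / ?g + 2 * \<eta>"
    using \<eta> by (simp add: field_simps)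
  also have "\<dots> < 1" using viol \<eta> by (simp add: field_simps)
  finally show ?thesis by (simp add: level_covers_def)
qed

lemma price_level_neq_1:
  assumes "0 < \<eta>" "1 \<le> Z" "price_level \<eta> Z y a v \<noteq> 1"
  shows "\<eta> * (1 + \<eta>) powr a < y v"
proof -
  have "nat \<lceil>y v / (\<eta> * (1 + \<eta>) powr a)\<rceil> > 1"
    using assms(2,3) unfolding price_level_def by linarith
  then have "1 < y v / (\<eta> * (1 + \<eta>) powr a)" by linarith
  then show ?thesis using assms by (simp add: field_simps)
qed

text \<open>A penalty exp (- x) per informative vertex makes the sum over all level vectors factor
  over the vertices: level 1 contributes 1, each of the other Z - 1 levels exp (- x). The union
  bound thus costs exp (card V * Z * exp (- x)) instead of Z ^ card V.\<close>

lemma sum_exp_non_trivial_levels: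
  fixes x :: real
  assumes V: "finite V" and Z: "1 \<le> Z"
  shows "(\<Sum>z\<in>V \<rightarrow>\<^sub>E {1..Z}. exp (- x * (card {v\<in>V. z v \<noteq> (1::nat)} + 1))) \<le>
    exp (- x) * exp (card V * Z * exp (- x))"
proof -
  have "exp (- x * (card {v\<in>V. z v \<noteq> (1::nat)} + 1)) =
      exp (- x) * (\<Prod>v\<in>V. if z v \<noteq> 1 then exp (- x) else 1)" for z
  proof -
    have "(\<Prod>v\<in>V. if z v \<noteq> 1 then exp (- x) else 1) = exp (- x) ^ card {v\<in>V. z v \<noteq> 1}"
      using V by (simp add: prod.inter_filter[symmetric])
    then show ?thesis by (simp add: algebra_simps exp_of_nat_mult[symmetric] flip: exp_add)
  qed
  then have "(\<Sum>z\<in>V \<rightarrow>\<^sub>E {1..Z}. exp (- x * (card {v\<in>V. z v \<noteq> (1::nat)} + 1))) =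
      exp (- x) * (\<Sum>z\<in>V \<rightarrow>\<^sub>E {1..Z}. \<Prod>v\<in>V. if z v \<noteq> 1 then exp (- x) else 1)"
    by (simp add: sum_distrib_left)
  also have "(\<Sum>z\<in>V \<rightarrow>\<^sub>E {1..Z}. \<Prod>v\<in>V. if z v \<noteq> 1 then exp (- x) else 1) =
      (\<Prod>v\<in>V. \<Sum>k\<in>{1..Z}. if k \<noteq> 1 then exp (- x) else 1)"
    using prod_sum_PiE[of V "\<lambda>_. {1..Z}" "\<lambda>v k. if k \<noteq> 1 then exp (- x) else 1"] V by simp
  also have "(\<Sum>k\<in>{1..Z}. if k \<noteq> 1 then exp (- x) else 1) = 1 + (real Z - 1) * exp (- x)"
    using Z by (simp add: sum.atLeast_Suc_atMost of_nat_diff)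
  also have "(\<Prod>v\<in>V. 1 + (real Z - 1) * exp (- x)) = (1 + (real Z - 1) * exp (- x)) ^ card V" by simp
  also have "\<dots> \<le> exp (Z * exp (- x)) ^ card V"
  proof (rule power_mono)
    have "1 + (real Z - 1) * exp (- x) \<le> 1 + Z * exp (- x)" by simp
    also have "\<dots> \<le> exp (Z * exp (- x))" by (rule exp_ge_add_one_self)
    finally show "1 + (real Z - 1) * exp (- x) \<le> exp (Z * exp (- x))" .
  qed (use Z in simp)
  also have "\<dots> = exp (card V * Z * exp (- x))" by (simp add: exp_of_nat_mult[symmetric] mult.assoc)
  finally show ?thesis by simp
qed

text \<open>Matching edges are disjoint, so the covered ones charge disjoint parts of the total
  price. That total is at most (1 - 4 * \<eta>) of the weight, and 1 - 4 * \<eta> \<le> (1 - 2 *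
  \<eta>)^2, so the covered edges miss a 2 * \<eta> fraction.\<close>

lemma uncovered_matching_weight:
  fixes y :: "'v \<Rightarrow> real" and \<omega> :: "'v set \<Rightarrow> real"
  assumes V: "finite V" and M: "finite M" "disjoint M" "\<And>e. e \<in> M \<Longrightarrow> e \<subseteq> V"
    and y: "\<And>v. 0 \<le> y v" and \<eta>: "0 < \<eta>" "\<eta> < 1 / 4"
    and le: "sum y V \<le> (1 - 4 * \<eta>) * sum \<omega> M" and \<omega>: "\<And>e. e \<in> M \<Longrightarrow> 0 \<le> \<omega> e"
  shows "2 * \<eta> * sum \<omega> M \<le> sum \<omega> {e\<in>M. sum y e < (1 - 2 * \<eta>) * \<omega> e}"
proof -
  let ?A = "{e\<in>M. sum y e < (1 - 2 * \<eta>) * \<omega> e}" and ?N = "{e\<in>M. \<not> sum y e < (1 - 2 * \<eta>) * \<omega> e}"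
  have split: "sum \<omega> M = sum \<omega> ?A + sum \<omega> ?N"
    using M(1) by (subst sum.union_disjoint[symmetric]) (auto intro!: sum.cong)
  have O: "0 \<le> sum \<omega> M" using \<omega> by (intro sum_nonneg)
  have "(1 - 2 * \<eta>) * sum \<omega> ?N = (\<Sum>e\<in>?N. (1 - 2 * \<eta>) * \<omega> e)" by (simp add: sum_distrib_left)
  also have "\<dots> \<le> (\<Sum>e\<in>?N. sum y e)" by (intro sum_mono) auto
  also have "\<dots> = sum y (\<Union>?N)"
    using V M finite_subset[OF M(3) V] by (subst sum.Union_disjoint) (auto simp: disjoint_def)
  also have "\<dots> \<le> sum y V" using V M y by (intro sum_mono2) auto
  also have "\<dots> \<le> (1 - 4 * \<eta>) * sum \<omega> M" by (rule le)
  also have "\<dots> \<le> (1 - 2 * \<eta>) * ((1 - 2 * \<eta>) * sum \<omega> M)"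
  proof -
    have "1 - 4 * \<eta> \<le> (1 - 2 * \<eta>) * (1 - 2 * \<eta>)" by (simp add: algebra_simps)
    then show ?thesis using O by (metis mult.assoc mult_right_mono)
  qed
  finally have "sum \<omega> ?N \<le> (1 - 2 * \<eta>) * sum \<omega> M" using \<eta> by simp
  then show ?thesis using split by (simp add: algebra_simps)
qed

text \<open>The classes only have to be controlled with respect to the number of informative price
  levels; summed over the classes these numbers form geometric series.\<close>

lemma sampled_violation_le:
  fixes y :: "'v \<Rightarrow> real" and p :: "'v \<Rightarrow> 'v set \<Rightarrow> real" and cl :: "'v set \<Rightarrow> int"
    and \<eta> \<kappa> W :: real
  assumes V: "finite V" and E: "finite E" "\<And>e. e \<in> E \<Longrightarrow> card e = 2"
    and y: "\<And>v. 0 \<le> y v" and \<eta>: "0 < \<eta>" "\<eta> \<le> 1" and Z: "1 \<le> Z" and \<kappa>: "0 \<le> \<kappa>"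
    and p: "\<And>v e. 0 \<le> p v e"
    and bd: "\<And>e. e \<in> E \<Longrightarrow> (1 + \<eta>) powr cl e \<le> W" "sum y V \<le> W" "0 \<le> W"
    and good: "\<And>a. a \<in> cl ` E \<Longrightarrow>
      (\<Sum>v\<in>P. \<Sum>e\<in>{e\<in>E. v \<in> e \<and> cl e = a \<and> \<not> level_covers \<eta> (price_level \<eta> Z y a) e}. p v e)
      \<le> \<kappa> * (card {v\<in>V. price_level \<eta> Z y a v \<noteq> 1} + 1)"
  shows "(\<Sum>v\<in>P. \<Sum>e\<in>{e\<in>E. v \<in> e \<and> sum y e < (1 - 2 * \<eta>) * (1 + \<eta>) powr cl e}.
      p v e * (1 + \<eta>) powr cl e) \<le> \<kappa> * (4 * W / \<eta>\<^sup>2)"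
proof -
  let ?g = "\<lambda>a::int. (1 + \<eta>) powr a" and ?D = "\<lambda>a. {v\<in>V. price_level \<eta> Z y a v \<noteq> 1}"
  let ?viol = "\<lambda>v. {e\<in>E. v \<in> e \<and> sum y e < (1 - 2 * \<eta>) * ?g (cl e)}"
  let ?unc = "\<lambda>v a. {e\<in>E. v \<in> e \<and> cl e = a \<and> \<not> level_covers \<eta> (price_level \<eta> Z y a) e}"
  have per: "(\<Sum>e\<in>?viol v. p v e * ?g (cl e)) \<le> (\<Sum>a\<in>cl ` E. ?g a * (\<Sum>e\<in>?unc v a. p v e))" for v
  proof -
    have "(\<Sum>e\<in>?viol v. p v e * ?g (cl e)) =
        (\<Sum>a\<in>cl ` E. \<Sum>e\<in>{e\<in>?viol v. cl e = a}. p v e * ?g (cl e))"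
      using E by (intro sum.group[symmetric]) auto
    also have "\<dots> = (\<Sum>a\<in>cl ` E. ?g a * (\<Sum>e\<in>{e\<in>?viol v. cl e = a}. p v e))"
      by (intro sum.cong refl) (simp add: sum_distrib_left mult.commute)
    also have "\<dots> \<le> (\<Sum>a\<in>cl ` E. ?g a * (\<Sum>e\<in>?unc v a. p v e))"
      using E p price_level_not_covers[OF \<eta>(1) y E(2)]
      by (intro sum_mono mult_left_mono sum_mono2) auto
    finally show ?thesis .
  qed
  have geo1: "(\<Sum>a\<in>cl ` E. ?g a) \<le> W * (1 + \<eta>) / \<eta>"
    using sum_powr_geometric[OF \<eta>(1), of "cl ` E" W] E bd by auto
  \<comment> \<open>After swapping the sums, a vertex is informative only in classes of weight below
    \<open>y v / \<eta>\<close>. Each vertex thus contributes one geometric series proportional to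
    its price, and the prices sum to at most W.\<close>
  have geo2: "(\<Sum>a\<in>cl ` E. ?g a * card (?D a)) \<le> W / \<eta> * (1 + \<eta>) / \<eta>"
  proof -
    have "(\<Sum>a\<in>cl ` E. ?g a * card (?D a)) = (\<Sum>a\<in>cl ` E. \<Sum>v\<in>?D a. ?g a)"
      by (simp add: mult.commute)
    also have "\<dots> = (\<Sum>v\<in>V. \<Sum>a\<in>{a\<in>cl ` E. price_level \<eta> Z y a v \<noteq> 1}. ?g a)"
      using V E by (intro sum.swap_restrict) auto
    also have "\<dots> \<le> (\<Sum>v\<in>V. y v / \<eta> * (1 + \<eta>) / \<eta>)"
    proof (intro sum_mono sum_powr_geometric)
      fix v a assume "a \<in> {a\<in>cl ` E. price_level \<eta> Z y a v \<noteq> 1}"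
      then have "\<eta> * ?g a < y v" using price_level_neq_1[OF \<eta>(1) Z] by auto
      then show "?g a \<le> y v / \<eta>" using \<eta> by (simp add: field_simps)
    qed (use \<eta> E y in auto)
    also have "\<dots> = sum y V * ((1 + \<eta>) / \<eta> / \<eta>)"
      unfolding sum_distrib_right by (intro sum.cong) auto
    also have "\<dots> \<le> W * ((1 + \<eta>) / \<eta> / \<eta>)" using bd \<eta> by (intro mult_right_mono) auto
    finally show ?thesis by simp
  qed
  have "(\<Sum>v\<in>P. \<Sum>e\<in>?viol v. p v e * ?g (cl e)) \<le>
      (\<Sum>v\<in>P. \<Sum>a\<in>cl ` E. ?g a * (\<Sum>e\<in>?unc v a. p v e))"
    by (rule sum_mono) (rule per)
  also have "\<dots> = (\<Sum>a\<in>cl ` E. ?g a * (\<Sum>v\<in>P. \<Sum>e\<in>?unc v a. p v e))"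
    by (subst sum.swap) (simp add: sum_distrib_left)
  also have "\<dots> \<le> (\<Sum>a\<in>cl ` E. ?g a * (\<kappa> * (card (?D a) + 1)))"
    using good by (intro sum_mono mult_left_mono) auto
  also have "\<dots> = \<kappa> * ((\<Sum>a\<in>cl ` E. ?g a * card (?D a)) + (\<Sum>a\<in>cl ` E. ?g a))"
    by (simp add: sum_distrib_left sum.distrib algebra_simps)
  also have "\<dots> \<le> \<kappa> * (W / \<eta> * (1 + \<eta>) / \<eta> + W * (1 + \<eta>) / \<eta>)"
    using geo1 geo2 \<kappa> by (intro mult_left_mono add_mono)
  also have "\<dots> \<le> \<kappa> * (4 * W / \<eta>\<^sup>2)"
  proof (intro mult_left_mono \<kappa>)
    have "W / \<eta> * (1 + \<eta>) / \<eta> + W * (1 + \<eta>) / \<eta> = W * ((1 + \<eta>) * (1 + \<eta>)) / \<eta>\<^sup>2"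
      using \<eta> by (simp add: field_simps power2_eq_square)
    also have "\<dots> \<le> W * (2 * 2) / \<eta>\<^sup>2"
      using \<eta> bd(3) by (intro divide_right_mono mult_left_mono mult_mono) auto
    finally show "W / \<eta> * (1 + \<eta>) / \<eta> + W * (1 + \<eta>) / \<eta> \<le> 4 * W / \<eta>\<^sup>2"
      by (simp add: mult.commute)
  qed
  finally show ?thesis .
qed

section \<open>Weight classes and their transmission\<close>

definition weight_class :: "real \<Rightarrow> real \<Rightarrow> int" where
  "weight_class \<eta> x = \<lfloor>log (1 + \<eta>) x\<rfloor>"

lemma weight_class_bounds:
  assumes "0 < \<eta>" "0 < x"
  shows "(1 + \<eta>) powr weight_class \<eta> x \<le> x" "x \<le> (1 + \<eta>) * (1 + \<eta>) powr weight_class \<eta> x"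
proof -
  have "(1 + \<eta>) powr weight_class \<eta> x \<le> (1 + \<eta>) powr log (1 + \<eta>) x"
    using assms by (intro powr_mono) (auto simp: weight_class_def)
  then show "(1 + \<eta>) powr weight_class \<eta> x \<le> x" using assms by simp
  have "log (1 + \<eta>) x \<le> 1 + weight_class \<eta> x" by (simp add: weight_class_def) linarith
  then have "(1 + \<eta>) powr log (1 + \<eta>) x \<le> (1 + \<eta>) powr (1 + weight_class \<eta> x)"
    using assms by (intro powr_mono) auto
  then show "x \<le> (1 + \<eta>) * (1 + \<eta>) powr weight_class \<eta> x"
    using assms by (simp add: powr_add)
qed

text \<open>A ratio of n^k spans k * ln n / ln (1 + \<eta>) on the logarithmic scale; the extra 1 in
  the hypothesis on K pays for the floors.\<close>

lemma weight_class_window: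
  assumes \<eta>: "0 < \<eta>" and n: "1 \<le> n" and w: "poly_weights k n E w" "finite E"
    and K: "real k * ln n / ln (1 + \<eta>) + 1 \<le> K" and ef: "e \<in> E" "f \<in> E"
  shows "\<bar>weight_class \<eta> (w e) - weight_class \<eta> (w f)\<bar> \<le> int K"
proof -
  have pos: "0 < w e" if "e \<in> E" for e using w that by (auto simp: poly_weights_def)
  have *: "weight_class \<eta> (w e) - weight_class \<eta> (w f) \<le> int K" if ef: "e \<in> E" "f \<in> E" for e f
  proof -
    have "w e / w f \<le> Max (w ` E) / Min (w ` E)"
    proof (rule frac_le)
      show "0 < Min (w ` E)" using w(2) ef pos by (subst Min_gr_iff) auto
      show "w e \<le> Max (w ` E)" "Min (w ` E) \<le> w f" using w(2) ef by auto
      show "0 \<le> Max (w ` E)" using \<open>w e \<le> Max (w ` E)\<close> pos[OF ef(1)] by linarith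
    qed
    also have "\<dots> \<le> real n ^ k" using w ef by (auto simp: poly_weights_def)
    finally have "ln (w e / w f) \<le> ln (real n ^ k)"
      using pos[OF ef(1)] pos[OF ef(2)] n by (subst ln_le_cancel_iff) auto
    then have "ln (w e) - ln (w f) \<le> k * ln n"
      using pos[OF ef(1)] pos[OF ef(2)] n by (simp add: ln_div ln_realpow)
    then have "log (1 + \<eta>) (w e) - log (1 + \<eta>) (w f) \<le> k * ln n / ln (1 + \<eta>)"
      using \<eta> by (simp add: log_def divide_right_mono flip: diff_divide_distrib)
    then show ?thesis using K unfolding weight_class_def by linarith
  qed
  show ?thesis using *[OF ef] *[OF ef(2,1)] by linarith
qed

text \<open>Players do not know the common scale of the weights, so they only report residues of
  weight classes modulo \<open>2 * K + 1\<close>, where \<open>K\<close> bounds the spread of the classes. This determines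
  the classes up to a common shift, and completely for a player that recognises an edge of its own.\<close>

definition class_residues :: "real \<Rightarrow> nat \<Rightarrow> 'v set set \<Rightarrow> ('v set \<Rightarrow> real) \<Rightarrow> ('v set \<times> int) set" where
  "class_residues \<eta> K E w = (\<lambda>e. (e, weight_class \<eta> (w e) mod (2 * int K + 1))) ` E"

definition consistent_classes :: "nat \<Rightarrow> ('v set \<times> int) set \<Rightarrow> ('v set \<Rightarrow> int) \<Rightarrow> bool" where
  "consistent_classes K S c \<longleftrightarrow> (\<forall>(e, r)\<in>S. c e mod (2 * int K + 1) = r) \<and>
     (\<forall>e\<in>fst ` S. \<forall>f\<in>fst ` S. \<bar>c e - c f\<bar> \<le> int K)"

text \<open>Two differences of size at most K are at most 2 * K apart, so congruence modulo 2 * K +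
  1 forces them to be equal. This fixes the modulus.\<close>

lemma consistent_classes_shift:
  assumes "consistent_classes K S c" "consistent_classes K S c'" "e \<in> fst ` S" "f \<in> fst ` S"
  shows "c e - c' e = c f - c' f"
proof -
  let ?M = "2 * int K + 1"
  have eq: "c x mod ?M = c' x mod ?M" if "x \<in> fst ` S" for x
    using assms(1,2) that unfolding consistent_classes_def by fastforce
  have "(c e - c f) mod ?M = (c' e - c' f) mod ?M"
    by (intro mod_diff_cong eq assms)
  then have "?M dvd (c e - c f) - (c' e - c' f)" by (simp add: mod_eq_dvd_iff)
  moreover have "\<bar>(c e - c f) - (c' e - c' f)\<bar> < ?M"
  proof -
    have "\<bar>c e - c f\<bar> \<le> int K" "\<bar>c' e - c' f\<bar> \<le> int K"
      using assms unfolding consistent_classes_def by blast+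
    then show ?thesis by linarith
  qed
  ultimately have "(c e - c f) - (c' e - c' f) = 0"
    using dvd_imp_le_int[of "(c e - c f) - (c' e - c' f)" ?M] by fastforce
  then show ?thesis by simp
qed

lemma consistent_weight_class:
  assumes "S \<subseteq> class_residues \<eta> K E w"
    and "\<And>e f. e \<in> E \<Longrightarrow> f \<in> E \<Longrightarrow> \<bar>weight_class \<eta> (w e) - weight_class \<eta> (w f)\<bar> \<le> int K"
  shows "consistent_classes K S (\<lambda>e. weight_class \<eta> (w e))"
  using assms unfolding consistent_classes_def class_residues_def by fastforce

definition decode_classes :: "real \<Rightarrow> nat \<Rightarrow> 'v local_info \<Rightarrow> ('v set \<times> int) set \<Rightarrow> 'v set \<Rightarrow> int" where
  "decode_classes \<eta> K x S = (SOME c. consistent_classes K S c \<and>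
     (\<exists>(e, u)\<in>x. e \<in> fst ` S \<and> c e = weight_class \<eta> u))"

text \<open>The true classes are one possible choice, and any choice agrees with them on some
  reported edge of the player; rigidity up to a shift spreads the agreement to all reported
  edges.\<close>

lemma decode_classes_eq:
  assumes S: "S \<subseteq> class_residues \<eta> K E w"
    and win: "\<And>e f. e \<in> E \<Longrightarrow> f \<in> E \<Longrightarrow> \<bar>weight_class \<eta> (w e) - weight_class \<eta> (w f)\<bar> \<le> int K"
    and own: "e0 \<in> fst ` S" "v \<in> e0" and e: "e \<in> fst ` S"
  shows "decode_classes \<eta> K (incident_edges E w v) S e = weight_class \<eta> (w e)"
proof -
  let ?Q = "\<lambda>c. consistent_classes K S c \<and>
     (\<exists>(e, u)\<in>incident_edges E w v. e \<in> fst ` S \<and> c e = weight_class \<eta> u)"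
  have con: "consistent_classes K S (\<lambda>e. weight_class \<eta> (w e))"
    by (rule consistent_weight_class[OF S win])
  have "e0 \<in> E" using S own by (auto simp: class_residues_def)
  then have "?Q (\<lambda>e. weight_class \<eta> (w e))" using own con by (fastforce simp: incident_edges_def)
  then have *: "?Q (decode_classes \<eta> K (incident_edges E w v) S)"
    unfolding decode_classes_def by (rule someI[of ?Q])
  then obtain f where f: "f \<in> fst ` S"
    "decode_classes \<eta> K (incident_edges E w v) S f = weight_class \<eta> (w f)"
    by (auto simp: incident_edges_def)
  show ?thesis using consistent_classes_shift[OF _ con e f(1)] * f(2) by fastforce
qed

section \<open>Output matching and the loss from rounding\<close>

definition best_matching :: "real \<Rightarrow> nat \<Rightarrow> ('v set \<times> int) set \<Rightarrow> 'v set set" where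
  "best_matching \<eta> K S = (let c = SOME c. consistent_classes K S c in
     SOME M. is_matching (fst ` S) M \<and> (\<forall>M'. is_matching (fst ` S) M' \<longrightarrow>
       (\<Sum>e\<in>M'. (1 + \<eta>) powr c e) \<le> (\<Sum>e\<in>M. (1 + \<eta>) powr c e)))"

lemma finite_matchings: "finite E \<Longrightarrow> finite {M. is_matching E M}"
  by (rule finite_subset[of _ "Pow E"]) (auto simp: is_matching_def)

lemma exists_best_matching:
  assumes "finite E"
  obtains M where "is_matching E M" "\<And>M'. is_matching E M' \<Longrightarrow> sum w M' \<le> (sum w M :: real)"
proof -
  have "{M. is_matching E M} \<noteq> {}" by (auto simp: is_matching_def disjoint_def)
  then obtain M where "M \<in> {M. is_matching E M}" "\<And>M'. M' \<in> {M. is_matching E M} \<Longrightarrow> sum w M' \<le> sum w M"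
    using finite_maximizer[OF finite_matchings[OF assms], of "sum w"] by blast
  then show thesis using that by blast
qed

text \<open>The output is computed from the board alone, where the classes are known only up to a
  common shift \<open>d\<close>. The shift multiplies the weight of every matching by the same
  factor, so optimality is unaffected.\<close>

lemma best_matching_properties:
  assumes S: "S \<subseteq> class_residues \<eta> K E w" "finite S" and \<eta>: "0 < \<eta>"
    and win: "\<And>e f. e \<in> E \<Longrightarrow> f \<in> E \<Longrightarrow> \<bar>weight_class \<eta> (w e) - weight_class \<eta> (w f)\<bar> \<le> int K"
  shows "is_matching (fst ` S) (best_matching \<eta> K S)"
    "is_matching (fst ` S) M' \<Longrightarrow> (\<Sum>e\<in>M'. (1 + \<eta>) powr weight_class \<eta> (w e))
      \<le> (\<Sum>e\<in>best_matching \<eta> K S. (1 + \<eta>) powr weight_class \<eta> (w e))"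
proof -
  define c where "c = (SOME c. consistent_classes K S c)"
  let ?cl = "\<lambda>e. weight_class \<eta> (w e)"
  let ?Q = "\<lambda>M. is_matching (fst ` S) M \<and> (\<forall>M'. is_matching (fst ` S) M' \<longrightarrow>
       (\<Sum>e\<in>M'. (1 + \<eta>) powr c e) \<le> (\<Sum>e\<in>M. (1 + \<eta>) powr c e))"
  have con: "consistent_classes K S ?cl" by (rule consistent_weight_class[OF S(1) win])
  then have c: "consistent_classes K S c" unfolding c_def by (rule someI[of "consistent_classes K S"])
  have "\<exists>M. ?Q M" using exists_best_matching[of "fst ` S" "\<lambda>e. (1 + \<eta>) powr c e"] S(2) by blast
  then have best: "?Q (best_matching \<eta> K S)"
    unfolding best_matching_def Let_def c_def by (rule someI_ex)
  then show "is_matching (fst ` S) (best_matching \<eta> K S)" by blast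
  obtain d where d: "\<And>e. e \<in> fst ` S \<Longrightarrow> c e = ?cl e + d"
  proof (cases "S = {}")
    case False
    then obtain f where f: "f \<in> fst ` S" by blast
    have "c e = ?cl e + (c f - ?cl f)" if "e \<in> fst ` S" for e
      using consistent_classes_shift[OF c con that f] by simp
    then show thesis using that by blast
  qed (use that in auto)
  have sums: "(\<Sum>e\<in>M. (1 + \<eta>) powr c e) = (1 + \<eta>) powr d * (\<Sum>e\<in>M. (1 + \<eta>) powr ?cl e)"
    if M: "is_matching (fst ` S) M" for M
    unfolding sum_distrib_left
  proof (rule sum.cong)
    fix e assume "e \<in> M"
    then have "e \<in> fst ` S" using M by (auto simp: is_matching_def)
    then show "(1 + \<eta>) powr c e = (1 + \<eta>) powr d * (1 + \<eta>) powr ?cl e"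
      using d by (simp add: powr_add)
  qed simp
  have "0 < (1 + \<eta>) powr d" using \<eta> by simp
  then show "(\<Sum>e\<in>M'. (1 + \<eta>) powr ?cl e) \<le> (\<Sum>e\<in>best_matching \<eta> K S. (1 + \<eta>) powr ?cl e)"
    if "is_matching (fst ` S) M'"
    using best that sums by (metis mult_le_cancel_left_pos)
qed

lemma best_matching_approx:
  assumes S: "S \<subseteq> class_residues \<eta> K E w" and E: "finite E" and \<eta>: "0 < \<eta>" "8 * \<eta> \<le> 1"
    and w: "\<And>e. e \<in> E \<Longrightarrow> 0 < w e"
    and win: "\<And>e f. e \<in> E \<Longrightarrow> f \<in> E \<Longrightarrow> \<bar>weight_class \<eta> (w e) - weight_class \<eta> (w f)\<bar> \<le> int K"
    and M0: "is_matching (fst ` S) M0"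
      "\<And>M'. is_matching E M' \<Longrightarrow> (1 - 5 * \<eta>) * (\<Sum>e\<in>M'. (1 + \<eta>) powr weight_class \<eta> (w e))
        \<le> (\<Sum>e\<in>M0. (1 + \<eta>) powr weight_class \<eta> (w e))"
  shows "approx_max_weight_matching (8 * \<eta>) E w (best_matching \<eta> K S)"
proof -
  let ?M = "best_matching \<eta> K S" and ?\<omega> = "\<lambda>e. (1 + \<eta>) powr weight_class \<eta> (w e)"
  have finS: "finite S" using S E finite_subset unfolding class_residues_def by blast
  have SE: "fst ` S \<subseteq> E" using S by (auto simp: class_residues_def)
  have M: "is_matching (fst ` S) ?M" "sum ?\<omega> M0 \<le> sum ?\<omega> ?M"
    using best_matching_properties[OF S finS \<eta>(1) win] M0 by auto
  then have ME: "is_matching E ?M" using SE by (auto simp: is_matching_def)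
  obtain M1 where M1: "is_matching E M1" "\<And>M'. is_matching E M' \<Longrightarrow> sum w M' \<le> sum w M1"
    using exists_best_matching[OF E] by blast
  have "max_matching_weight E w = sum w M1"
    unfolding max_matching_weight_def
    using M1 finite_matchings[OF E] by (intro Max_eqI) auto
  moreover have "(1 - 8 * \<eta>) * sum w M1 \<le> sum w ?M"
  proof -
    have "sum w M1 \<le> (\<Sum>e\<in>M1. (1 + \<eta>) * ?\<omega> e)"
      using M1 w weight_class_bounds(2)[OF \<eta>(1)] by (intro sum_mono) (auto simp: is_matching_def)
    then have "(1 - 8 * \<eta>) * sum w M1 \<le> (1 - 8 * \<eta>) * ((1 + \<eta>) * sum ?\<omega> M1)"
      using \<eta> by (intro mult_left_mono) (auto simp: sum_distrib_left)
    also have "\<dots> = ((1 - 8 * \<eta>) * (1 + \<eta>)) * sum ?\<omega> M1" by simp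
    \<comment> \<open>The product is 1 - 7 * \<eta> - 8 * \<eta>^2: rounding to classes loses a
      factor 1 + \<eta> on top of the loss 5 * \<eta>.\<close>
    also have "\<dots> \<le> (1 - 5 * \<eta>) * sum ?\<omega> M1"
      using \<eta> by (intro mult_right_mono sum_nonneg) (auto simp: algebra_simps)
    also have "\<dots> \<le> sum ?\<omega> M0" by (rule M0(2)[OF M1(1)])
    also have "\<dots> \<le> sum ?\<omega> ?M" by (rule M(2))
    also have "\<dots> \<le> sum w ?M"
      using ME w weight_class_bounds(1)[OF \<eta>(1)] by (intro sum_mono) (auto simp: is_matching_def)
    finally show ?thesis .
  qed
  ultimately show ?thesis using ME by (simp add: approx_max_weight_matching_def)
qed

section \<open>Runs of a protocol\<close>

lemma length_blackboard:
  "b \<in> set_pmf (blackboard_after P \<pi> x t) \<Longrightarrow> length b = t"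
  by (induction t arbitrary: b) auto

lemma blackboard_message:
  assumes "finite P" "b \<in> set_pmf (blackboard_after P \<pi> x t)" "i < t" "v \<in> P"
  shows "(b ! i) v \<in> set_pmf (message \<pi> v (x v) (take i b))"
  using assms(2,3)
proof (induction t arbitrary: b)
  case (Suc t)
  then obtain b' m where b: "b = b' @ [m]" "b' \<in> set_pmf (blackboard_after P \<pi> x t)"
    "m \<in> set_pmf (Pi_pmf P [] (\<lambda>v. message \<pi> v (x v) b'))" by auto
  have len: "length b' = t" by (rule length_blackboard[OF b(2)])
  show ?case
  proof (cases "i < t")
    case True
    then show ?thesis using Suc.IH[OF b(2)] len by (simp add: b nth_append)
  next
    case False
    then have "i = t" using Suc.prems by simp
    then show ?thesis using b(3) len assms by (auto simp: b set_Pi_pmf PiE_dflt_def)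
  qed
qed simp

text \<open>Rounds only append. Hence an event about one phase can be estimated at the end of that
  phase and transferred to the full run.\<close>

lemma blackboard_take:
  assumes "s \<le> t"
  shows "map_pmf (take s) (blackboard_after P \<pi> x t) = blackboard_after P \<pi> x s"
  using assms
proof (induction t)
  case (Suc t)
  show ?case
  proof (cases "s = Suc t")
    case True
    have "map_pmf (take s) (blackboard_after P \<pi> x s) = map_pmf (\<lambda>b. b) (blackboard_after P \<pi> x s)"
      by (intro map_pmf_cong refl) (simp add: length_blackboard)
    then show ?thesis using True by (metis map_pmf_ident)
  next
    case False
    then have s: "s \<le> t" using Suc.prems by simp
    have "map_pmf (take s) (blackboard_after P \<pi> x (Suc t)) =
        bind_pmf (blackboard_after P \<pi> x t) (\<lambda>b.
          map_pmf (\<lambda>m. take s (b @ [m])) (Pi_pmf P [] (\<lambda>v. message \<pi> v (x v) b)))"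
      by (simp add: map_bind_pmf pmf.map_comp o_def)
    also have "\<dots> = bind_pmf (blackboard_after P \<pi> x t) (\<lambda>b. return_pmf (take s b))"
      using s by (intro bind_pmf_cong refl) (simp add: length_blackboard)
    also have "\<dots> = map_pmf (take s) (blackboard_after P \<pi> x t)" by (simp add: map_pmf_def)
    finally show ?thesis using Suc.IH s by simp
  qed
qed simp

lemma total_bits_le:
  fixes B :: real
  assumes "\<And>m v. m \<in> set b \<Longrightarrow> v \<in> P \<Longrightarrow> real (length (m v)) \<le> B"
  shows "real (total_bits P b) \<le> length b * (card P * B)"
proof -
  have "real (total_bits P b) = (\<Sum>m\<leftarrow>b. real (\<Sum>v\<in>P. length (m v)))"
    unfolding total_bits_def by (induction b) auto
  also have "\<dots> \<le> (\<Sum>m\<leftarrow>b. card P * B)"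
    using assms by (intro sum_list_mono) (simp add: sum_bounded_above)
  finally show ?thesis by (simp add: sum_list_triv)
qed

lemma mwm_protocolI:
  fixes B :: real
  assumes P: "finite (smaller_side L R)" and rounds: "real (rounds \<pi>) \<le> T"
    and S: "real (rounds \<pi>) * (card (smaller_side L R) * B) \<le> S"
    and good: "\<And>E w. bipartite_graph L R E \<Longrightarrow> poly_weights k (card (L \<union> R)) E w \<Longrightarrow>
      measure_pmf.prob (run L R \<pi> E w) {b. approx_max_weight_matching \<epsilon> E w (outcome \<pi> b)} \<ge> 1 - \<delta>"
    and B: "\<And>v x b m. v \<in> smaller_side L R \<Longrightarrow> m \<in> set_pmf (message \<pi> v x b) \<Longrightarrow> real (length m) \<le> B"
  shows "mwm_protocol L R k \<epsilon> \<delta> T B S \<pi>"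
proof -
  let ?P = "smaller_side L R"
  have len: "real (length (m v)) \<le> B"
    if b: "b \<in> set_pmf (run L R \<pi> E w)" "m \<in> set b" "v \<in> ?P" for E w b m v
  proof -
    obtain i where i: "i < length b" "m = b ! i" using b(2) by (metis in_set_conv_nth)
    have "i < rounds \<pi>" using i length_blackboard b(1) unfolding run_def by metis
    then show ?thesis
      using blackboard_message[OF P _ _ b(3)] b(1) i B[OF b(3)] unfolding run_def by blast
  qed
  moreover have "real (total_bits ?P b) \<le> S" if b: "b \<in> set_pmf (run L R \<pi> E w)" for b E w
  proof -
    have "real (total_bits ?P b) \<le> length b * (card ?P * B)" using len[OF b] by (intro total_bits_le)
    then show ?thesis using S length_blackboard b unfolding run_def by fastforce
  qed
  ultimately show ?thesis using rounds good unfolding mwm_protocol_def by blast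
qed

section \<open>Reporting all edges\<close>

text \<open>The alphabet of possible reports. It depends only on the vertex set and K, so question
  lists and codes built from it are public before the graph is known.\<close>

definition edge_residues :: "'v set \<Rightarrow> 'v set \<Rightarrow> nat \<Rightarrow> ('v set \<times> int) set" where
  "edge_residues P Q K = {{u, v} | u v. u \<in> P \<and> v \<in> Q} \<times> {0..<2 * int K + 1}"

lemma finite_edge_residues:
  assumes "finite P" "finite Q"
  shows "finite (edge_residues P Q K)" "card (edge_residues P Q K) \<le> card P * card Q * (2 * K + 1)"
proof -
  have *: "{{u, v} | u v. u \<in> P \<and> v \<in> Q} = (\<lambda>(u, v). {u, v}) ` (P \<times> Q)" by auto
  then show "finite (edge_residues P Q K)" using assms by (simp add: edge_residues_def)
  have "card {{u, v} | u v. u \<in> P \<and> v \<in> Q} \<le> card P * card Q"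
    unfolding * using card_image_le[of "P \<times> Q" "\<lambda>(u, v). {u, v}"] assms by (simp add: card_cartesian_product)
  moreover have c: "card {0..<2 * int K + 1} = 2 * K + 1" by simp
  ultimately show "card (edge_residues P Q K) \<le> card P * card Q * (2 * K + 1)"
    unfolding edge_residues_def card_cartesian_product c by (intro mult_le_mono1)
qed

lemma class_residues_subset:
  assumes "bipartite_graph P Q E" shows "class_residues \<eta> K E w \<subseteq> edge_residues P Q K"
proof -
  have "a mod (2 * int K + 1) \<in> {0..<2 * int K + 1}" for a
    using pos_mod_bound[of "2 * int K + 1" a] by auto
  then show ?thesis
    using assms unfolding class_residues_def edge_residues_def bipartite_graph_def by blast
qed

definition bitwise_protocol :: "'v set \<Rightarrow> real \<Rightarrow> nat \<Rightarrow> ('v set \<times> int) list \<Rightarrow> 'v protocol" where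
  "bitwise_protocol P \<eta> K xs = \<lparr>rounds = length xs,
     message = \<lambda>v x b. return_pmf
       [xs ! length b \<in> (\<lambda>(e, u). (e, weight_class \<eta> u mod (2 * int K + 1))) ` x],
     outcome = \<lambda>b. best_matching \<eta> K {xs ! t | t. t < length b \<and> (\<exists>v\<in>P. (b ! t) v = [True])}\<rparr>"

text \<open>Every edge has an endpoint in P that confirms it in the round of its residue, so the
  reported set is exactly \<open>class_residues\<close>. An optimal matching of E for the rounded
  weights then serves as the witness \<open>M0\<close>.\<close>

lemma bitwise_protocol_outcome:
  assumes E: "bipartite_graph P Q E" and \<eta>: "0 < \<eta>" "8 * \<eta> \<le> 1" and n: "1 \<le> n"
    and w: "poly_weights k n E w" and K: "real k * ln n / ln (1 + \<eta>) + 1 \<le> K"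
    and xs: "set xs = edge_residues P Q K"
    and b: "b \<in> set_pmf (blackboard_after P (bitwise_protocol P \<eta> K xs) (incident_edges E w) (length xs))"
  shows "approx_max_weight_matching (8 * \<eta>) E w (outcome (bitwise_protocol P \<eta> K xs) b)"
proof -
  let ?S = "{xs ! t | t. t < length b \<and> (\<exists>v\<in>P. (b ! t) v = [True])}"
  let ?C = "class_residues \<eta> K E w"
  have finP: "finite P" using E by (simp add: bipartite_graph_def)
  have len: "length b = length xs" by (rule length_blackboard[OF b])
  have msg: "(b ! t) v = [True] \<longleftrightarrow> (\<exists>e\<in>E. v \<in> e \<and> xs ! t = (e, weight_class \<eta> (w e) mod (2 * int K + 1)))"
    if "t < length xs" "v \<in> P" for t v
    using blackboard_message[OF finP b that] that len
    by (auto simp: bitwise_protocol_def incident_edges_def image_iff)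
  have "?S = ?C"
  proof (intro set_eqI iffI)
    fix s assume "s \<in> ?S"
    then show "s \<in> ?C" using msg len by (auto simp: class_residues_def)
  next
    fix s assume s: "s \<in> ?C"
    then obtain e where e: "e \<in> E" "s = (e, weight_class \<eta> (w e) mod (2 * int K + 1))"
      by (auto simp: class_residues_def)
    obtain v where v: "v \<in> P" "v \<in> e" by (rule bipartite_edgeE[OF E e(1)]) blast
    have "s \<in> set xs" using s class_residues_subset[OF E] xs by blast
    then obtain t where t: "t < length xs" "xs ! t = s" by (metis in_set_conv_nth)
    have "(b ! t) v = [True]" using msg[OF t(1) v(1)] t e v by auto
    then show "s \<in> ?S" using t len v by auto
  qed
  moreover have fstC: "fst ` ?C = E" by (force simp: class_residues_def)
  moreover obtain M0 where M0: "is_matching E M0" "\<And>M'. is_matching E M' \<Longrightarrow>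
      (\<Sum>e\<in>M'. (1 + \<eta>) powr weight_class \<eta> (w e)) \<le> (\<Sum>e\<in>M0. (1 + \<eta>) powr weight_class \<eta> (w e))"
    using exists_best_matching[OF bipartite_graph_finite[OF E], of "\<lambda>e. (1 + \<eta>) powr weight_class \<eta> (w e)"] by blast
  moreover have "approx_max_weight_matching (8 * \<eta>) E w (best_matching \<eta> K ?C)"
  proof (rule best_matching_approx[where ?M0.0 = M0])
    show "(1 - 5 * \<eta>) * (\<Sum>e\<in>M'. (1 + \<eta>) powr weight_class \<eta> (w e))
        \<le> (\<Sum>e\<in>M0. (1 + \<eta>) powr weight_class \<eta> (w e))" if "is_matching E M'" for M'
    proof -
      have "0 \<le> (\<Sum>e\<in>M'. (1 + \<eta>) powr weight_class \<eta> (w e))" by (intro sum_nonneg) simp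
      then have "(1 - 5 * \<eta>) * (\<Sum>e\<in>M'. (1 + \<eta>) powr weight_class \<eta> (w e))
          \<le> 1 * (\<Sum>e\<in>M'. (1 + \<eta>) powr weight_class \<eta> (w e))"
        using \<eta> by (intro mult_right_mono) auto
      then show ?thesis using M0(2)[OF that] by simp
    qed
  qed (use bipartite_graph_finite[OF E] \<eta> w M0 fstC
        weight_class_window[OF \<eta>(1) n w bipartite_graph_finite[OF E] K] in
        \<open>auto simp: poly_weights_def\<close>)
  ultimately show ?thesis by (simp add: bitwise_protocol_def)
qed

section \<open>The sampling protocol\<close>

text \<open>There are \<open>T\<close> phases of \<open>N\<close> rounds; in each round a player reports \<open>r\<close> independent samples
  from a distribution on its edges that is fixed during the phase. At the end of a phase, nearly
  optimal dual prices of the set of all reported edges become common knowledge, and every player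
  doubles the sampling weight of its edges that these prices fail to cover. \<open>Z\<close> is the number of
  price levels used in the union bound.\<close>

locale sampling_protocol =
  fixes P Q :: "'v set" and k n K r N T Z :: nat and \<eta> :: real
    and enc :: "('v set \<times> int) list \<Rightarrow> bool list" and dec :: "bool list \<Rightarrow> ('v set \<times> int) list"
  assumes finP: "finite P" and finQ: "finite Q" and n: "n = card (P \<union> Q)" "2 \<le> n"
    and \<eta>: "0 < \<eta>" "8 * \<eta> \<le> 1"
    and K: "real k * ln n / ln (1 + \<eta>) + 1 \<le> K" and r: "1 \<le> r" and N: "1 \<le> N"
    and Z: "1 \<le> \<eta> * Z"
    and T: "3 * (1 + (k + 2) * ln n) / \<eta> < T"
    and dec_enc: "\<And>es. length es = r \<Longrightarrow> set es \<subseteq> edge_residues P Q K \<Longrightarrow> dec (enc es) = es"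
    and dec_Nil: "dec [] = []"
begin

definition reports :: "'v blackboard \<Rightarrow> ('v set \<times> int) set" where
  "reports b = (\<Union>m\<in>set b. \<Union>v\<in>P. set (dec (m v)))"

text \<open>The choice is a function of the reported graph and its classes only, so that all who
  know these two agree on the prices.\<close>

definition prices :: "('v set \<Rightarrow> int) \<Rightarrow> 'v set set \<Rightarrow> 'v \<Rightarrow> real" where
  "prices c H = (SOME y. (\<forall>v. 0 \<le> y v) \<and> (\<forall>e\<in>H. (1 + \<eta>) powr c e \<le> sum y e) \<and>
     (\<exists>M. is_matching H M \<and> sum y (P \<union> Q) \<le> (1 + \<eta>) * (\<Sum>e\<in>M. (1 + \<eta>) powr c e)))"

definition phase_reports :: "'v blackboard \<Rightarrow> nat \<Rightarrow> ('v set \<times> int) set" where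
  "phase_reports b t = reports (take (Suc t * N) b)"

definition player_prices :: "'v local_info \<Rightarrow> 'v blackboard \<Rightarrow> nat \<Rightarrow> 'v \<Rightarrow> real" where
  "player_prices x b t = prices (decode_classes \<eta> K x (phase_reports b t)) (fst ` phase_reports b t)"

definition own_class :: "'v local_info \<Rightarrow> 'v set \<Rightarrow> int" where
  "own_class x e = weight_class \<eta> (THE u. (e, u) \<in> x)"

definition violated :: "'v local_info \<Rightarrow> 'v blackboard \<Rightarrow> nat \<Rightarrow> 'v set \<Rightarrow> bool" where
  "violated x b t e \<longleftrightarrow> sum (player_prices x b t) e < (1 - 2 * \<eta>) * (1 + \<eta>) powr own_class x e"

definition violations :: "'v local_info \<Rightarrow> 'v blackboard \<Rightarrow> nat \<Rightarrow> 'v set \<Rightarrow> nat" where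
  "violations x b s e = (\<Sum>t<s. of_bool (violated x b t e))"

text \<open>A player has at most n edges, and rounded weights differ by a factor of at most n^(k +
  1). With initial mass 1 / n^(k + 2) the initial potential is therefore at most the weight of any
  single edge, while ln (1 / \<pi>) is only (k + 2) * ln n.\<close>

definition player_mass :: "'v local_info \<Rightarrow> 'v blackboard \<Rightarrow> nat \<Rightarrow> 'v set \<Rightarrow> real" where
  "player_mass x b s = (let \<omega> = (\<lambda>e. (1 + \<eta>) powr own_class x e); \<pi> = 1 / real n ^ (k + 2) in
     sampling_mass \<pi> \<omega> (violations x b s) (level \<pi> \<omega> (fst ` x) (violations x b s)))"

definition sampler :: "'v local_info \<Rightarrow> 'v blackboard \<Rightarrow> nat \<Rightarrow> 'v set pmf" where
  "sampler x b s = (SOME p. set_pmf p \<subseteq> fst ` x \<and> (\<forall>e\<in>fst ` x. player_mass x b s e \<le> pmf p e))"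

definition sample_message :: "'v local_info \<Rightarrow> 'v set list \<Rightarrow> bool list" where
  "sample_message x es = enc (map (\<lambda>e. (e, own_class x e mod (2 * int K + 1))) es)"

text \<open>\<open>length b div N\<close> is the current phase, and the sampler reads completed
  phases only. A player without edges has no distribution to sample from and writes the empty
  string.\<close>

definition protocol :: "'v protocol" where
  "protocol = \<lparr>rounds = N * T,
     message = \<lambda>v x b. if x = {} then return_pmf [] else
       map_pmf (sample_message x) (replicate_pmf r (sampler x b (length b div N))),
     outcome = \<lambda>b. best_matching \<eta> K (reports b)\<rparr>"

lemma phase_reports_take: "Suc t \<le> s \<Longrightarrow> phase_reports (take (s * N) b) t = phase_reports b t"
  unfolding phase_reports_def by (metis min_absorb1 mult_le_mono1 take_take)

lemma violations_take: "violations x (take (s * N) b) s = violations x b s"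
  unfolding violations_def violated_def player_prices_def
  by (intro ext sum.cong refl) (simp add: phase_reports_take Suc_le_eq)

lemma sampler_take: "sampler x (take (s * N) b) s = sampler x b s"
  unfolding sampler_def player_mass_def violations_take ..

text \<open>Decoded classes are arbitrary off the reported edges; prices must not see that.\<close>

lemma prices_cong:
  assumes "\<And>e. e \<in> H \<Longrightarrow> c e = c' e"
  shows "prices c H = prices c' H"
proof -
  have sums: "(\<Sum>e\<in>M. (1 + \<eta>) powr c e) = (\<Sum>e\<in>M. (1 + \<eta>) powr c' e)" if "is_matching H M" for M
    using that assms by (intro sum.cong) (auto simp: is_matching_def)
  show ?thesis unfolding prices_def using assms sums by (intro arg_cong[where f = Eps] ext) (auto cong: conj_cong)
qed

lemma prices_properties:
  assumes H: "bipartite_graph P Q H"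
  shows "0 \<le> prices c H v" "e \<in> H \<Longrightarrow> (1 + \<eta>) powr c e \<le> sum (prices c H) e"
    "\<exists>M. is_matching H M \<and> sum (prices c H) (P \<union> Q) \<le> (1 + \<eta>) * (\<Sum>e\<in>M. (1 + \<eta>) powr c e)"
proof -
  let ?\<omega> = "\<lambda>e. (1 + \<eta>) powr c e"
  let ?R = "\<lambda>y. (\<forall>v. 0 \<le> y v) \<and> (\<forall>e\<in>H. ?\<omega> e \<le> sum y e) \<and>
     (\<exists>M. is_matching H M \<and> sum y (P \<union> Q) \<le> (1 + \<eta>) * sum ?\<omega> M)"
  have finH: "finite H" by (rule bipartite_graph_finite[OF H])
  \<comment> \<open>A bid increment of \<eta> times the least weight turns the additive error per
    matched edge into the factor 1 + \<eta>; the inserted 1 is for empty H.\<close>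
  define \<delta> where "\<delta> = \<eta> * Min (insert 1 (?\<omega> ` H))"
  have \<delta>: "0 < \<delta>" using \<eta> finH by (auto simp: \<delta>_def)
  have \<delta>\<omega>: "\<delta> \<le> \<eta> * ?\<omega> e" if "e \<in> H" for e
    using \<eta> finH that by (auto simp: \<delta>_def)
  obtain M y where My: "is_matching H M" "\<And>v. 0 \<le> y v" "\<And>e. e \<in> H \<Longrightarrow> ?\<omega> e \<le> sum y e"
    "sum y (P \<union> Q) \<le> sum ?\<omega> M + \<delta> * real (card M)"
    using auction_dual[OF H \<delta>, of ?\<omega>] by auto
  have "\<delta> * real (card M) = (\<Sum>e\<in>M. \<delta>)" by simp
  also have "\<dots> \<le> (\<Sum>e\<in>M. \<eta> * ?\<omega> e)" using My(1) \<delta>\<omega> by (intro sum_mono) (auto simp: is_matching_def)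
  finally have "sum y (P \<union> Q) \<le> (1 + \<eta>) * sum ?\<omega> M"
    using My(4) by (simp add: sum_distrib_left[symmetric] algebra_simps)
  then have "?R y" using My by blast
  then have "?R (prices c H)" unfolding prices_def by (rule someI[of ?R])
  then show "0 \<le> prices c H v" "e \<in> H \<Longrightarrow> ?\<omega> e \<le> sum (prices c H) e"
    "\<exists>M. is_matching H M \<and> sum (prices c H) (P \<union> Q) \<le> (1 + \<eta>) * sum ?\<omega> M" by blast+
qed

end

locale sampling_run = sampling_protocol +
  fixes E :: "'a set set" and w :: "'a set \<Rightarrow> real"
  assumes E: "bipartite_graph P Q E" and w: "poly_weights k n E w"
begin

abbreviation V :: "'a set" where "V \<equiv> P \<union> Q"

abbreviation info :: "'a \<Rightarrow> 'a local_info" where "info \<equiv> incident_edges E w"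

abbreviation board :: "nat \<Rightarrow> 'a blackboard pmf" where
  "board \<equiv> blackboard_after P protocol info"

abbreviation cl :: "'a set \<Rightarrow> int" where "cl e \<equiv> weight_class \<eta> (w e)"

abbreviation \<omega> :: "'a set \<Rightarrow> real" where "\<omega> e \<equiv> (1 + \<eta>) powr cl e"

lemma finE: "finite E"
  by (rule bipartite_graph_finite[OF E])

lemma finV: "finite V"
  using finP finQ by simp

lemma w_pos: "e \<in> E \<Longrightarrow> 0 < w e"
  using w by (auto simp: poly_weights_def)

lemma window: "e \<in> E \<Longrightarrow> f \<in> E \<Longrightarrow> \<bar>cl e - cl f\<bar> \<le> int K"
  using weight_class_window[OF \<eta>(1) _ w finE K] n by simp

lemma card_edge: "e \<in> E \<Longrightarrow> card e = 2"
  by (rule bipartite_edgeE[OF E]) auto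

lemma edge_subset: "e \<in> E \<Longrightarrow> e \<subseteq> V" "e \<in> E \<Longrightarrow> finite e"
  using bipartite_edge_subset[OF E] by auto

lemma fst_info: "fst ` info v = {e \<in> E. v \<in> e}"
  by (force simp: incident_edges_def)

lemma info_empty: "info v = {} \<longleftrightarrow> {e \<in> E. v \<in> e} = {}"
  using fst_info[of v] by auto

lemma own_class_info: "e \<in> E \<Longrightarrow> v \<in> e \<Longrightarrow> own_class (info v) e = cl e"
  by (auto simp: own_class_def incident_edges_def)

lemma card_incident: "card {e \<in> E. v \<in> e} \<le> n"
proof -
  have "e \<in> (\<lambda>u. {v, u}) ` V" if e: "e \<in> E" "v \<in> e" for e
    by (rule bipartite_edgeE[OF E e(1)]) (use e in auto)
  then have "{e \<in> E. v \<in> e} \<subseteq> (\<lambda>u. {v, u}) ` V" by auto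
  then have "card {e \<in> E. v \<in> e} \<le> card ((\<lambda>u. {v, u}) ` V)" by (intro card_mono) (use finV in auto)
  also have "\<dots> \<le> n" using n card_image_le[OF finV] by auto
  finally show ?thesis .
qed

text \<open>The given ratio is n^k; rounding costs another factor 1 + \<eta> \<le> n.\<close>

lemma \<omega>_le: assumes "e \<in> E" "f \<in> E" shows "\<omega> f \<le> real n ^ (k + 1) * \<omega> e"
proof -
  have "\<omega> f \<le> w f" using weight_class_bounds(1)[OF \<eta>(1)] w_pos assms by auto
  also have "\<dots> \<le> real n ^ k * w e"
  proof -
    have "Min (w ` E) > 0" using finE assms w_pos by (subst Min_gr_iff) auto
    moreover have "w f \<le> Max (w ` E)" "Min (w ` E) \<le> w e" using finE assms by auto
    moreover have "Max (w ` E) \<le> real n ^ k * Min (w ` E)"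
      using w assms calculation(1) by (auto simp: poly_weights_def field_simps)
    ultimately show ?thesis by (meson mult_left_mono of_nat_0_le_iff order_trans zero_le_power)
  qed
  also have "\<dots> \<le> real n ^ k * ((1 + \<eta>) * \<omega> e)"
    using weight_class_bounds(2)[OF \<eta>(1)] w_pos assms by (intro mult_left_mono) auto
  also have "\<dots> \<le> real n ^ k * (n * \<omega> e)"
    using n \<eta> by (intro mult_left_mono mult_right_mono) auto
  finally show ?thesis by (simp add: mult_ac)
qed

section \<open>Support of a run\<close>

lemma sampler_properties:
  assumes "info v \<noteq> {}"
  shows "set_pmf (sampler (info v) b s) \<subseteq> {e \<in> E. v \<in> e}"
    "e \<in> E \<Longrightarrow> v \<in> e \<Longrightarrow> player_mass (info v) b s e \<le> pmf (sampler (info v) b s) e"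
proof -
  let ?A = "fst ` info v"
  have "\<exists>p. set_pmf p \<subseteq> ?A \<and> (\<forall>e\<in>?A. player_mass (info v) b s e \<le> pmf p e)"
  proof (rule exists_pmf_ge)
    show "finite ?A" using finE by (simp add: fst_info)
    show "?A \<noteq> {}" using assms by simp
    show "0 \<le> player_mass (info v) b s e" for e
      by (simp add: player_mass_def sampling_mass_def Let_def)
    show "sum (player_mass (info v) b s) ?A \<le> 1"
      using \<eta> \<open>finite ?A\<close> unfolding player_mass_def Let_def by (intro level_properties(2)) auto
  qed
  then have "set_pmf (sampler (info v) b s) \<subseteq> ?A \<and>
      (\<forall>e\<in>?A. player_mass (info v) b s e \<le> pmf (sampler (info v) b s) e)"
    unfolding sampler_def by (rule someI_ex)
  then show "set_pmf (sampler (info v) b s) \<subseteq> {e \<in> E. v \<in> e}"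
    "e \<in> E \<Longrightarrow> v \<in> e \<Longrightarrow> player_mass (info v) b s e \<le> pmf (sampler (info v) b s) e"
    by (auto simp: fst_info)
qed

lemma dec_sample_message:
  assumes "length es = r" "set es \<subseteq> {e \<in> E. v \<in> e}"
  shows "dec (sample_message (info v) es) = map (\<lambda>e. (e, cl e mod (2 * int K + 1))) es"
proof -
  have *: "map (\<lambda>e. (e, own_class (info v) e mod (2 * int K + 1))) es = map (\<lambda>e. (e, cl e mod (2 * int K + 1))) es"
    using assms own_class_info by (intro map_cong) auto
  have "set (map (\<lambda>e. (e, cl e mod (2 * int K + 1))) es) \<subseteq> class_residues \<eta> K E w"
    using assms by (auto simp: class_residues_def)
  then show ?thesis
    unfolding sample_message_def * using assms class_residues_subset[OF E, of \<eta> K w] by (intro dec_enc) auto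
qed

lemma set_message:
  assumes "m \<in> set_pmf (message protocol v (info v) b)"
  shows "set (dec m) \<subseteq> class_residues \<eta> K {e \<in> E. v \<in> e} w" "info v \<noteq> {} \<Longrightarrow> dec m \<noteq> []"
proof -
  have "set (dec m) \<subseteq> class_residues \<eta> K {e \<in> E. v \<in> e} w \<and> (info v \<noteq> {} \<longrightarrow> dec m \<noteq> [])"
  proof (cases "info v = {}")
    case True
    then show ?thesis using assms by (simp add: protocol_def dec_Nil)
  next
    case False
    then obtain es where m: "m = sample_message (info v) es"
      and es': "es \<in> set_pmf (replicate_pmf r (sampler (info v) b (length b div N)))"
      using assms by (auto simp: protocol_def)
    have es: "m = sample_message (info v) es" "length es = r" "set es \<subseteq> {e \<in> E. v \<in> e}"
      using m es' sampler_properties(1)[OF False]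
      by (auto simp: set_replicate_pmf in_lists_conv_set subset_iff)
    then show ?thesis using dec_sample_message[OF es(2,3)] r by (auto simp: class_residues_def)
  qed
  then show "set (dec m) \<subseteq> class_residues \<eta> K {e \<in> E. v \<in> e} w" "info v \<noteq> {} \<Longrightarrow> dec m \<noteq> []" by auto
qed

lemma reports_subset:
  assumes "b \<in> set_pmf (board t)"
  shows "reports (take i b) \<subseteq> class_residues \<eta> K E w"
proof -
  have "set (dec (m v)) \<subseteq> class_residues \<eta> K E w" if m: "m \<in> set b" "v \<in> P" for m v
  proof -
    obtain j where j: "j < t" "m = b ! j" using m length_blackboard[OF assms] by (metis in_set_conv_nth)
    then have "set (dec (m v)) \<subseteq> class_residues \<eta> K {e \<in> E. v \<in> e} w"
      using set_message(1) blackboard_message[OF finP assms j(1) m(2)] by blast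
    then show ?thesis by (auto simp: class_residues_def)
  qed
  then show ?thesis using set_take_subset[of i b] unfolding reports_def by blast
qed

lemma fst_reports:
  assumes "b \<in> set_pmf (board t)"
  shows "fst ` reports (take i b) \<subseteq> E" "bipartite_graph P Q (fst ` reports (take i b))"
proof -
  show "fst ` reports (take i b) \<subseteq> E"
    using reports_subset[OF assms] by (force simp: class_residues_def)
  then show "bipartite_graph P Q (fst ` reports (take i b))"
    using E unfolding bipartite_graph_def by blast
qed

definition board_prices :: "'a blackboard \<Rightarrow> nat \<Rightarrow> 'a \<Rightarrow> real" where
  "board_prices b t = prices cl (fst ` phase_reports b t)"

text \<open>Since 1 \<le> r, a player with edges reports one of its own already in the first round.
  That edge calibrates its classes at the end of every phase, so all such players work with the
  prices of the true classes.\<close>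

lemma player_prices_eq:
  assumes b: "b \<in> set_pmf (board i)" "Suc t * N \<le> i" and v: "v \<in> P" "info v \<noteq> {}"
  shows "player_prices (info v) b t = board_prices b t"
proof -
  let ?S = "phase_reports b t"
  have len: "length b = i" by (rule length_blackboard[OF b(1)])
  have i0: "0 < Suc t * N" "0 < i" using N b(2) by (auto intro: Nat.gr0I)
  have "(b ! 0) v \<in> set_pmf (message protocol v (info v) (take 0 b))"
    by (rule blackboard_message[OF finP b(1) i0(2) v(1)])
  note msg = set_message[OF this]
  have "hd (dec ((b ! 0) v)) \<in> set (dec ((b ! 0) v))" using msg(2) v by simp
  moreover from this msg(1) have "hd (dec ((b ! 0) v)) \<in> class_residues \<eta> K {e \<in> E. v \<in> e} w" by blast
  ultimately obtain e u where e: "(e, u) \<in> set (dec ((b ! 0) v))" "v \<in> e"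
    unfolding class_residues_def by auto
  have "b ! 0 \<in> set (take (Suc t * N) b)" using i0 len b(2) by (auto simp: in_set_conv_nth intro!: exI[of _ 0])
  then have "(e, u) \<in> ?S" using e v unfolding phase_reports_def reports_def by blast
  then have "decode_classes \<eta> K (info v) ?S f = cl f" if "f \<in> fst ` ?S" for f
    using e(2) that reports_subset[OF b(1)] unfolding phase_reports_def
    by (intro decode_classes_eq[where ?e0.0 = e and E = E] window) force+
  then show ?thesis unfolding player_prices_def board_prices_def by (intro prices_cong)
qed

lemma violated_iff:
  assumes "b \<in> set_pmf (board i)" "Suc t * N \<le> i" "v \<in> P" "e \<in> E" "v \<in> e"
  shows "violated (info v) b t e \<longleftrightarrow> sum (board_prices b t) e < (1 - 2 * \<eta>) * \<omega> e"
proof -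
  have "info v \<noteq> {}" using info_empty assms by blast
  from player_prices_eq[OF assms(1-3) this] show ?thesis
    using own_class_info[OF assms(4,5)] by (simp add: violated_def)
qed

section \<open>Probability of a bad phase\<close>

definition uncovered_prob :: "int \<Rightarrow> ('a \<Rightarrow> nat) \<Rightarrow> nat \<Rightarrow> 'a blackboard \<Rightarrow> 'a \<Rightarrow> real" where
  "uncovered_prob a z s b v = (if info v = {} then 0 else
     measure_pmf.prob (sampler (info v) b s) {e. cl e = a \<and> \<not> level_covers \<eta> z e})"

definition covered_message :: "int \<Rightarrow> ('a \<Rightarrow> nat) \<Rightarrow> bool list \<Rightarrow> bool" where
  "covered_message a z m \<longleftrightarrow> (\<forall>(e, u)\<in>set (dec m). cl e = a \<longrightarrow> level_covers \<eta> z e)"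

text \<open>For levels \<open>z\<close> fixed in advance: much uncovered sampling mass, yet no
  sample of the phase reveals it. The threshold grows with the number of informative levels, so that
  vectors with more of them, which are more numerous, fail with smaller probability. Only samples
  from phase \<open>s\<close> on count, as its distributions are fixed when it starts.\<close>

definition bad_phase :: "real \<Rightarrow> int \<Rightarrow> ('a \<Rightarrow> nat) \<Rightarrow> nat \<Rightarrow> 'a blackboard set" where
  "bad_phase \<kappa> a z s = {b. \<kappa> * (card {v\<in>V. z v \<noteq> 1} + 1) < (\<Sum>v\<in>P. uncovered_prob a z s b v) \<and>
     (\<forall>m\<in>set (drop (s * N) b). \<forall>v\<in>P. covered_message a z (m v))}"

lemma prob_covered_message_le:
  assumes "length b div N = s"
  shows "measure_pmf.prob (message protocol v (info v) b) {m. covered_message a z m}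
    \<le> exp (- (r * uncovered_prob a z s b v))"
proof (cases "info v = {}")
  case True
  then show ?thesis by (simp add: uncovered_prob_def)
next
  case False
  let ?p = "sampler (info v) b s" and ?B = "{e. cl e = a \<longrightarrow> level_covers \<eta> z e}"
  have "measure_pmf.prob (message protocol v (info v) b) {m. covered_message a z m} =
      measure_pmf.prob (replicate_pmf r ?p) (sample_message (info v) -` {m. covered_message a z m})"
    using False assms by (simp add: protocol_def)
  also have "\<dots> \<le> measure_pmf.prob (replicate_pmf r ?p) {es. set es \<subseteq> ?B}"
  proof (rule measure_pmf.finite_measure_mono_AE, unfold AE_measure_pmf_iff, intro ballI impI)
    fix es assume "es \<in> set_pmf (replicate_pmf r ?p)"
      and cov: "es \<in> sample_message (info v) -` {m. covered_message a z m}"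
    then have "length es = r" "set es \<subseteq> {e \<in> E. v \<in> e}"
      using sampler_properties(1)[OF False] by (auto simp: set_replicate_pmf in_lists_conv_set subset_iff)
    from dec_sample_message[OF this] cov show "es \<in> {es. set es \<subseteq> ?B}"
      by (auto simp: covered_message_def)
  qed auto
  also have "\<dots> \<le> measure_pmf.prob ?p ?B ^ r" by (rule prob_replicate_pmf_subset_le)
  also have "measure_pmf.prob ?p ?B = 1 - uncovered_prob a z s b v"
  proof -
    have "?B = UNIV - {e. cl e = a \<and> \<not> level_covers \<eta> z e}" by auto
    then have "measure_pmf.prob ?p ?B = 1 - measure_pmf.prob ?p {e. cl e = a \<and> \<not> level_covers \<eta> z e}"
      using measure_pmf.prob_compl[of "{e. cl e = a \<and> \<not> level_covers \<eta> z e}" ?p] by simp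
    then show ?thesis using False by (simp add: uncovered_prob_def)
  qed
  also have "(1 - uncovered_prob a z s b v) ^ r \<le> exp (- uncovered_prob a z s b v) ^ r"
  proof (rule power_mono)
    show "1 - uncovered_prob a z s b v \<le> exp (- uncovered_prob a z s b v)"
      using exp_ge_add_one_self[of "- uncovered_prob a z s b v"] by simp
    show "0 \<le> 1 - uncovered_prob a z s b v" by (simp add: uncovered_prob_def)
  qed
  also have "\<dots> = exp (- (r * uncovered_prob a z s b v))" by (simp add: exp_of_nat_mult[symmetric])
  finally show ?thesis .
qed

lemma uncovered_prob_take: "uncovered_prob a z s (take (s * N) b) v = uncovered_prob a z s b v"
  by (simp add: uncovered_prob_def sampler_take)

text \<open>Within the phase the samplers do not change, so each round contributes the same factor.
  The players' coins are independent, so their failure probabilities multiply and the uncovered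
  masses add up in the exponent.\<close>

lemma prob_bad_phase_le:
  fixes \<kappa> :: real
  assumes \<kappa>: "0 \<le> \<kappa>" and j: "j \<le> N"
  shows "measure_pmf.prob (board (s * N + j)) (bad_phase \<kappa> a z s)
    \<le> exp (- (r * (\<kappa> * (card {v\<in>V. z v \<noteq> 1} + 1)))) ^ j"
  using j
proof (induction j)
  case (Suc j)
  let ?D = "\<kappa> * (card {v\<in>V. z v \<noteq> 1} + 1)" and ?bad = "bad_phase \<kappa> a z s"
  let ?step = "\<lambda>b. map_pmf (\<lambda>m. b @ [m]) (Pi_pmf P [] (\<lambda>v. message protocol v (info v) b))"
  have ext: "b @ [m] \<in> ?bad \<longleftrightarrow> b \<in> ?bad \<and> (\<forall>v\<in>P. covered_message a z (m v))"
    if "b \<in> set_pmf (board (s * N + j))" for b m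
  proof -
    have len: "length b = s * N + j" by (rule length_blackboard[OF that])
    then have "take (s * N) (b @ [m]) = take (s * N) b" by simp
    then have "uncovered_prob a z s (b @ [m]) v = uncovered_prob a z s b v" for v
      by (metis uncovered_prob_take)
    then show ?thesis using len by (auto simp: bad_phase_def)
  qed
  have "measure_pmf.prob (board (s * N + Suc j)) ?bad = measure_pmf.prob (bind_pmf (board (s * N + j)) ?step) ?bad"
    by simp
  also have "\<dots> \<le> exp (- (r * ?D)) * measure_pmf.prob (board (s * N + j)) ?bad"
  proof (rule prob_bind_pmf_le)
    fix b assume b: "b \<in> set_pmf (board (s * N + j))" "b \<in> ?bad"
    have len: "length b div N = s" using length_blackboard[OF b(1)] Suc.prems by simp
    have "measure_pmf.prob (?step b) ?bad =
        measure_pmf.prob (Pi_pmf P [] (\<lambda>v. message protocol v (info v) b)) (Pi P (\<lambda>_. {m. covered_message a z m}))"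
      using ext[OF b(1)] b(2) by (simp add: vimage_def Pi_def Ball_def)
    also have "\<dots> = (\<Prod>v\<in>P. measure_pmf.prob (message protocol v (info v) b) {m. covered_message a z m})"
      by (rule measure_Pi_pmf_Pi[OF finP])
    also have "\<dots> \<le> (\<Prod>v\<in>P. exp (- (r * uncovered_prob a z s b v)))"
      using prob_covered_message_le[OF len] by (intro prod_mono) auto
    also have "\<dots> = exp (- (r * (\<Sum>v\<in>P. uncovered_prob a z s b v)))"
      using finP by (simp add: exp_sum sum_distrib_left flip: sum_negf)
    also have "\<dots> \<le> exp (- (r * ?D))" using b(2) by (simp add: bad_phase_def mult_left_mono)
    finally show "measure_pmf.prob (?step b) ?bad \<le> exp (- (r * ?D))" .
  next
    fix b assume b: "b \<in> set_pmf (board (s * N + j))" "b \<notin> ?bad"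
    then show "measure_pmf.prob (?step b) ?bad = 0" using ext[OF b(1)] by (simp add: vimage_def)
  qed simp
  also have "\<dots> \<le> exp (- (r * ?D)) * exp (- (r * ?D)) ^ j"
    using Suc by (intro mult_left_mono) auto
  finally show ?case by simp
qed simp

definition bad_run :: "real \<Rightarrow> 'a blackboard set" where
  "bad_run \<kappa> = (\<Union>(s, a, z)\<in>{..<T} \<times> cl ` E \<times> (V \<rightarrow>\<^sub>E {1..Z}).
     {b. take (Suc s * N) b \<in> bad_phase \<kappa> a z s})"

lemma prob_bad_run_le:
  fixes \<kappa> :: real
  assumes \<kappa>: "0 \<le> \<kappa>"
  defines "x \<equiv> N * r * \<kappa>"
  shows "measure_pmf.prob (board (N * T)) (bad_run \<kappa>) \<le>
    T * (card E * (exp (- x) * exp (n * Z * exp (- x))))"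
proof -
  let ?I = "{..<T} \<times> cl ` E \<times> (V \<rightarrow>\<^sub>E {1..Z})"
  have Z1: "1 \<le> Z" using Z \<eta> by (cases Z) auto
  have finI: "finite ?I" using finE finV by (intro finite_cartesian_product finite_PiE) auto
  have one: "measure_pmf.prob (board (N * T)) {b. take (Suc s * N) b \<in> bad_phase \<kappa> a z s}
      \<le> exp (- x * (card {v\<in>V. z v \<noteq> 1} + 1))" if s: "s < T" for s a z
  proof -
    have "s * N + N \<le> N * T" using s by (metis Suc_leI add.commute mult.commute mult_Suc mult_le_mono1)
    then have eq: "board (s * N + N) = map_pmf (take (Suc s * N)) (board (N * T))"
      using blackboard_take[of "s * N + N" "N * T" P protocol info] by (simp add: add.commute)
    have "measure_pmf.prob (board (N * T)) {b. take (Suc s * N) b \<in> bad_phase \<kappa> a z s} =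
        measure_pmf.prob (board (s * N + N)) (bad_phase \<kappa> a z s)"
      unfolding eq measure_map_pmf vimage_def ..
    also have "\<dots> \<le> exp (- (r * (\<kappa> * (card {v\<in>V. z v \<noteq> 1} + 1)))) ^ N"
      by (rule prob_bad_phase_le[OF \<kappa> order_refl])
    also have "\<dots> = exp (- x * (card {v\<in>V. z v \<noteq> 1} + 1))"
      by (simp add: exp_of_nat_mult[symmetric] x_def algebra_simps)
    finally show ?thesis .
  qed
  have "measure_pmf.prob (board (N * T)) (bad_run \<kappa>) \<le>
      (\<Sum>(s, a, z)\<in>?I. measure_pmf.prob (board (N * T)) {b. take (Suc s * N) b \<in> bad_phase \<kappa> a z s})"
    unfolding bad_run_def
    using measure_pmf.finite_measure_subadditive_finite[OF finI,
      of "\<lambda>(s, a, z). {b. take (Suc s * N) b \<in> bad_phase \<kappa> a z s}" "board (N * T)"]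
    by (simp add: case_prod_beta)
  also have "\<dots> \<le> (\<Sum>(s, a, z)\<in>?I. exp (- x * (card {v\<in>V. z v \<noteq> 1} + 1)))"
    using one by (intro sum_mono) auto
  \<comment> \<open>The penalty per informative level now meets the sum over all level vectors;
    phases and classes enter only as the factors T and at most card E.\<close>
  also have "\<dots> = T * (card (cl ` E) * (\<Sum>z\<in>V \<rightarrow>\<^sub>E {1..Z}. exp (- x * (card {v\<in>V. z v \<noteq> 1} + 1))))"
    by (simp add: sum.cartesian_product[symmetric])
  also have "\<dots> \<le> T * (card E * (exp (- x) * exp (card V * Z * exp (- x))))"
    using card_image_le[OF finE, of cl] sum_exp_non_trivial_levels[OF finV Z1, of x]
    by (intro mult_left_mono mult_mono sum_nonneg) auto
  finally show ?thesis using n by simp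
qed

section \<open>Good runs\<close>

definition price_violated :: "'a blackboard \<Rightarrow> nat \<Rightarrow> 'a set \<Rightarrow> bool" where
  "price_violated b t e \<longleftrightarrow> sum (board_prices b t) e < (1 - 2 * \<eta>) * \<omega> e"

definition sampled_violation :: "'a blackboard \<Rightarrow> nat \<Rightarrow> 'a \<Rightarrow> real" where
  "sampled_violation b t v =
     (\<Sum>e\<in>{e\<in>E. v \<in> e \<and> price_violated b t e}. pmf (sampler (info v) b t) e * \<omega> e)"

lemma board_prices_properties:
  assumes "b \<in> set_pmf (board i)"
  shows "0 \<le> board_prices b t v"
    "e \<in> fst ` phase_reports b t \<Longrightarrow> \<omega> e \<le> sum (board_prices b t) e"
    "\<exists>M. is_matching (fst ` phase_reports b t) M \<and> sum (board_prices b t) V \<le> (1 + \<eta>) * sum \<omega> M"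
  unfolding board_prices_def phase_reports_def
  by (rule prices_properties[OF fst_reports(2)[OF assms]]; assumption?)+

text \<open>The regret bound for one player: the initial potential gives the summand 1, the initial
  mass (k + 2) * ln n, and sampling probabilities dominate the masses.\<close>

lemma player_violations_le:
  assumes b: "b \<in> set_pmf (board (N * T))" and v: "v \<in> P" and e: "e \<in> E" "v \<in> e"
  shows "ln 2 * \<omega> e * real (\<Sum>t<T. of_bool (price_violated b t e)) \<le>
    \<omega> e * (1 + (k + 2) * ln n) + (\<Sum>t<T. sampled_violation b t v)"
proof -
  let ?A = "{e \<in> E. v \<in> e}" and ?\<omega> = "\<lambda>e. (1 + \<eta>) powr own_class (info v) e"
  let ?\<pi> = "1 / real n ^ (k + 2)" and ?c = "\<lambda>s. violations (info v) b s"
  have ne: "info v \<noteq> {}" using info_empty e by blast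
  have finA: "finite ?A" using finE by simp
  have \<omega>: "?\<omega> f = \<omega> f" if "f \<in> ?A" for f using that own_class_info by simp
  have viol: "violated (info v) b t f \<longleftrightarrow> price_violated b t f" if "t < T" "f \<in> ?A" for t f
  proof -
    have "Suc t * N \<le> N * T" using that by (metis Suc_leI mult.commute mult_le_mono1)
    then show ?thesis using violated_iff[OF b _ v] that by (simp add: price_violated_def)
  qed
  have card: "?\<pi> * card ?A \<le> 1"
  proof -
    have "real (card ?A) \<le> real n * 1" using card_incident[of v] by simp
    also have "\<dots> \<le> real n * real n ^ (k + 1)" using n by (intro mult_left_mono one_le_power) auto
    finally show ?thesis using n by (simp add: field_simps)
  qed
  have sum\<omega>: "?\<pi> * sum ?\<omega> ?A \<le> \<omega> e"
  proof -
    have "sum ?\<omega> ?A = sum \<omega> ?A" using \<omega> by (rule sum.cong[OF refl])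
    also have "\<dots> \<le> real (card ?A) * (real n ^ (k + 1) * \<omega> e)"
      using \<omega>_le[OF e(1)] by (intro sum_bounded_above) auto
    also have "\<dots> \<le> real n * (real n ^ (k + 1) * \<omega> e)"
      using card_incident[of v] by (intro mult_right_mono) auto
    finally show ?thesis using n by (simp add: field_simps)
  qed
  have mass: "player_mass (info v) b t = sampling_mass ?\<pi> ?\<omega> (?c t) (level ?\<pi> ?\<omega> ?A (?c t))" for t
    by (simp only: player_mass_def Let_def fst_info)
  have "ln 2 * ?\<omega> e * real (?c T e) \<le> ?\<omega> e * ln (1 / ?\<pi>) + ?\<pi> * sum ?\<omega> ?A +
    (\<Sum>t<T. \<Sum>f\<in>{f\<in>?A. violated (info v) b t f}. player_mass (info v) b t f * ?\<omega> f)"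
    unfolding mass
  proof (rule multiscale_weights[OF finA _ _ card])
    show "0 < ?\<pi>" using n by simp
  qed (use \<eta> e in \<open>auto simp: violations_def\<close>)
  also have "(\<Sum>t<T. \<Sum>f\<in>{f\<in>?A. violated (info v) b t f}. player_mass (info v) b t f * ?\<omega> f)
      \<le> (\<Sum>t<T. sampled_violation b t v)"
  proof (rule sum_mono)
    fix t assume "t \<in> {..<T}"
    then have "{f\<in>?A. violated (info v) b t f} = {f\<in>E. v \<in> f \<and> price_violated b t f}"
      using viol by auto
    then show "(\<Sum>f\<in>{f\<in>?A. violated (info v) b t f}. player_mass (info v) b t f * ?\<omega> f)
        \<le> sampled_violation b t v"
      unfolding sampled_violation_def using sampler_properties(2)[OF ne] own_class_info
      by (auto intro!: sum_mono mult_right_mono)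
  qed
  finally have "ln 2 * ?\<omega> e * real (?c T e) \<le> ?\<omega> e * ln (1 / ?\<pi>) + ?\<pi> * sum ?\<omega> ?A +
      (\<Sum>t<T. sampled_violation b t v)" by simp
  moreover have "?c T e = (\<Sum>t<T. of_bool (price_violated b t e))"
    using viol e by (simp add: violations_def)
  moreover have "ln (1 / ?\<pi>) = (k + 2) * ln n"
    using n by (simp only: ln_realpow div_by_1 divide_divide_eq_right mult_1_left)
  ultimately have "ln 2 * \<omega> e * real (\<Sum>t<T. of_bool (price_violated b t e)) \<le>
      \<omega> e * ((k + 2) * ln n) + \<omega> e + (\<Sum>t<T. sampled_violation b t v)"
    using sum\<omega> own_class_info[OF e] by simp
  then show ?thesis by (simp add: algebra_simps)
qed

text \<open>Here the dependence of prices on samples is resolved: the levels of the actual prices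
  are one of the vectors in the union bound, and they cover every report of the phase. In a good run
  their uncovered mass is therefore small in every class.\<close>

lemma sampled_violation_phase_le:
  assumes b: "b \<in> set_pmf (board (N * T))" "b \<notin> bad_run \<kappa>" and t: "t < T" and \<kappa>: "0 \<le> \<kappa>"
    and W: "\<And>e. e \<in> E \<Longrightarrow> \<omega> e \<le> W" "sum (board_prices b t) V \<le> W" "0 \<le> W"
  shows "(\<Sum>v\<in>P. sampled_violation b t v) \<le> \<kappa> * (4 * W / \<eta>\<^sup>2)"
proof -
  let ?y = "board_prices b t"
  let ?p = "\<lambda>v e. pmf (sampler (info v) b t) e"
  have Z1: "1 \<le> Z" using Z \<eta> by (cases Z) auto
  have fin_reports: "e \<in> E" if "e \<in> fst ` phase_reports b t" for e
    using fst_reports(1)[OF b(1)] that unfolding phase_reports_def by blast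
  have "(\<Sum>v\<in>P. \<Sum>e\<in>{e\<in>E. v \<in> e \<and> sum ?y e < (1 - 2 * \<eta>) * \<omega> e}. ?p v e * \<omega> e)
      \<le> \<kappa> * (4 * W / \<eta>\<^sup>2)"
  proof (rule sampled_violation_le[OF finV finE card_edge _ \<eta>(1) _ Z1 \<kappa> _ W])
    fix a assume a: "a \<in> cl ` E"
    \<comment> \<open>Restriction to V puts the levels into the finite set of the union bound; edges
      lie in V, so covering is unchanged.\<close>
    let ?z = "price_level \<eta> Z ?y a" and ?z' = "restrict (price_level \<eta> Z ?y a) V"
    have z_eq: "level_covers \<eta> ?z' e \<longleftrightarrow> level_covers \<eta> ?z e" if "e \<in> E" for e
      using edge_subset(1)[OF that] by (simp add: level_covers_def subset_iff cong: sum.cong_simp)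
    have "?z' \<in> V \<rightarrow>\<^sub>E {1..Z}" using price_level_bounds[OF Z1, of \<eta> ?y a] by (intro PiE_I) auto
    then have "take (Suc t * N) b \<notin> bad_phase \<kappa> a ?z' t" using b(2) t a by (auto simp: bad_run_def)
    moreover have "covered_message a ?z' (m v)"
      if m: "m \<in> set (drop (t * N) (take (Suc t * N) b))" "v \<in> P" for m v
      unfolding covered_message_def
    proof (intro ballI, clarify)
      fix e u assume e: "(e, u) \<in> set (dec (m v))" "a = cl e"
      have "m \<in> set (take (Suc t * N) b)" using m(1) by (rule in_set_dropD)
      then have e_rep: "e \<in> fst ` phase_reports b t"
        using e m(2) unfolding phase_reports_def reports_def by force
      then have "\<omega> e \<le> sum ?y e" by (rule board_prices_properties(2)[OF b(1)])
      then have "level_covers \<eta> (price_level \<eta> Z ?y (cl e)) e"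
        by (rule price_level_covers[OF \<eta>(1) Z board_prices_properties(1)[OF b(1)]
              edge_subset(2)[OF fin_reports[OF e_rep]]])
      then show "level_covers \<eta> (restrict (price_level \<eta> Z ?y (cl e)) V) e"
        using z_eq[OF fin_reports[OF e_rep]] e by simp
    qed
    ultimately have "(\<Sum>v\<in>P. uncovered_prob a ?z' t (take (Suc t * N) b) v) \<le> \<kappa> * (card {v\<in>V. ?z' v \<noteq> 1} + 1)"
      by (auto simp: bad_phase_def not_less)
    moreover have "uncovered_prob a ?z' t (take (Suc t * N) b) v = uncovered_prob a ?z' t b v" for v
    proof -
      have "take (t * N) (take (Suc t * N) b) = take (t * N) b" by (simp add: min_def)
      then show ?thesis by (metis uncovered_prob_take)
    qed
    moreover have "{v\<in>V. ?z' v \<noteq> 1} = {v\<in>V. ?z v \<noteq> 1}" by auto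
    ultimately have le: "(\<Sum>v\<in>P. uncovered_prob a ?z' t b v) \<le> \<kappa> * (card {v\<in>V. ?z v \<noteq> 1} + 1)" by simp
    have "(\<Sum>e\<in>{e\<in>E. v \<in> e \<and> cl e = a \<and> \<not> level_covers \<eta> ?z e}. ?p v e) \<le> uncovered_prob a ?z' t b v"
      for v
    proof (cases "info v = {}")
      case True
      then have "{e\<in>E. v \<in> e \<and> cl e = a \<and> \<not> level_covers \<eta> ?z e} = {}" using info_empty by blast
      then show ?thesis by (simp only: sum.empty) (simp add: uncovered_prob_def)
    next
      case False
      have "(\<Sum>e\<in>{e\<in>E. v \<in> e \<and> cl e = a \<and> \<not> level_covers \<eta> ?z e}. ?p v e) =
          measure_pmf.prob (sampler (info v) b t) {e\<in>E. v \<in> e \<and> cl e = a \<and> \<not> level_covers \<eta> ?z e}"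
        using finE by (intro measure_measure_pmf_finite[symmetric]) auto
      also have "\<dots> \<le> uncovered_prob a ?z' t b v"
        using False z_eq by (auto simp: uncovered_prob_def intro!: measure_pmf.finite_measure_mono)
      finally show ?thesis .
    qed
    then have "(\<Sum>v\<in>P. \<Sum>e\<in>{e\<in>E. v \<in> e \<and> cl e = a \<and> \<not> level_covers \<eta> ?z e}. ?p v e)
        \<le> (\<Sum>v\<in>P. uncovered_prob a ?z' t b v)" by (rule sum_mono)
    with le show "(\<Sum>v\<in>P. \<Sum>e\<in>{e\<in>E. v \<in> e \<and> cl e = a \<and> \<not> level_covers \<eta> ?z e}. ?p v e)
        \<le> \<kappa> * (card {v\<in>V. ?z v \<noteq> 1} + 1)" by simp
  qed (use \<eta> board_prices_properties(1)[OF b(1)] in auto)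
  then show ?thesis unfolding sampled_violation_def price_violated_def .
qed

text \<open>Upper and lower bounds on the violations of an optimal matching \<open>M1\<close> clash
  if the reports stay poor. The choice \<kappa> = \<eta>^3 / 4 makes the sampled violation of a
  phase at most \<eta> times the optimum.\<close>

lemma good_run_outcome:
  assumes b: "b \<in> set_pmf (board (N * T))" "b \<notin> bad_run (\<eta> ^ 3 / 4)"
  shows "approx_max_weight_matching (8 * \<eta>) E w (outcome protocol b)"
proof -
  have b_take: "take (N * T) b = b" using length_blackboard[OF b(1)] by simp
  have rep: "reports b \<subseteq> class_residues \<eta> K E w"
    using reports_subset[OF b(1), of "N * T"] b_take by simp
  have HE: "fst ` reports b \<subseteq> E" using rep by (force simp: class_residues_def)
  have finH: "finite (fst ` reports b)" using HE finE by (rule finite_subset)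
  obtain M0 where M0: "is_matching (fst ` reports b) M0"
    "\<And>M. is_matching (fst ` reports b) M \<Longrightarrow> sum \<omega> M \<le> sum \<omega> M0"
    using exists_best_matching[OF finH, of \<omega>] by blast
  obtain M1 where M1: "is_matching E M1" "\<And>M. is_matching E M \<Longrightarrow> sum \<omega> M \<le> sum \<omega> M1"
    using exists_best_matching[OF finE, of \<omega>] by blast
  let ?O = "sum \<omega> M1"
  have M1E: "M1 \<subseteq> E" "disjoint M1" "finite M1"
    using M1(1) finE finite_subset by (auto simp: is_matching_def)
  have main: "(1 - 5 * \<eta>) * ?O \<le> sum \<omega> M0"
  proof (rule ccontr)
    assume neg: "\<not> ?thesis"
    have "0 \<le> sum \<omega> M0" by (intro sum_nonneg) simp
    then have "0 < (1 - 5 * \<eta>) * ?O" using neg by linarith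
    then have Opos: "0 < ?O" using \<eta> by (simp add: zero_less_mult_iff)
    \<comment> \<open>Reports of earlier phases contain no better matching than the final ones, and
      (1 + \<eta>) * (1 - 5 * \<eta>) \<le> 1 - 4 * \<eta>.\<close>
    have yV: "sum (board_prices b t) V \<le> (1 - 4 * \<eta>) * ?O" for t
    proof -
      obtain M where M: "is_matching (fst ` phase_reports b t) M"
        "sum (board_prices b t) V \<le> (1 + \<eta>) * sum \<omega> M"
        using board_prices_properties(3)[OF b(1)] by blast
      have "phase_reports b t \<subseteq> reports b"
        unfolding phase_reports_def reports_def using set_take_subset[of _ b] by blast
      then have "is_matching (fst ` reports b) M"
        using M(1) image_mono[of _ "reports b" fst] unfolding is_matching_def by blast
      then have "sum \<omega> M \<le> (1 - 5 * \<eta>) * ?O" using M0(2) neg by fastforce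
      then have "(1 + \<eta>) * sum \<omega> M \<le> (1 + \<eta>) * ((1 - 5 * \<eta>) * ?O)" using \<eta> by (intro mult_left_mono) auto
      also have "\<dots> = ((1 + \<eta>) * (1 - 5 * \<eta>)) * ?O" by (simp add: mult.assoc)
      also have "\<dots> \<le> (1 - 4 * \<eta>) * ?O"
        using \<eta> Opos by (intro mult_right_mono) (auto simp: algebra_simps)
      finally show ?thesis using M(2) by linarith
    qed
    have "2 * \<eta> * ?O * T \<le> (\<Sum>t<T. sum \<omega> {e\<in>M1. price_violated b t e})"
    proof -
      have "2 * \<eta> * ?O \<le> sum \<omega> {e\<in>M1. price_violated b t e}" for t
        unfolding price_violated_def using \<eta> M1E edge_subset yV board_prices_properties(1)[OF b(1)]
        by (intro uncovered_matching_weight[OF finV]) auto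
      then have "(\<Sum>t<T. 2 * \<eta> * ?O) \<le> (\<Sum>t<T. sum \<omega> {e\<in>M1. price_violated b t e})" by (intro sum_mono)
      then show ?thesis by (simp add: mult.commute)
    qed
    also have "\<dots> = (\<Sum>t<T. \<Sum>e\<in>M1. \<omega> e * of_bool (price_violated b t e))"
      using M1E by (simp add: sum.inter_filter of_bool_def if_distrib cong: if_cong)
    also have "\<dots> = (\<Sum>e\<in>M1. \<omega> e * real (\<Sum>t<T. of_bool (price_violated b t e)))"
      by (subst sum.swap) (simp only: sum_distrib_left of_nat_sum of_nat_of_bool)
    finally have lower: "2 * \<eta> * ?O * T \<le> (\<Sum>e\<in>M1. \<omega> e * real (\<Sum>t<T. of_bool (price_violated b t e)))" .
    \<comment> \<open>Each edge of \<open>M1\<close> is charged to its player. Distinct edges have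
      distinct players, so the sampled violation of a player is counted at most once.\<close>
    define pl where "pl e = (SOME v. v \<in> e \<inter> P)" for e
    have pl: "pl e \<in> e" "pl e \<in> P" if "e \<in> M1" for e
    proof -
      have "e \<in> E" using that M1E by blast
      then have "\<exists>v. v \<in> e \<inter> P" by (rule bipartite_edgeE[OF E]) blast
      then have "pl e \<in> e \<inter> P" unfolding pl_def by (rule someI_ex)
      then show "pl e \<in> e" "pl e \<in> P" by auto
    qed
    have inj: "inj_on pl M1"
    proof (rule inj_onI)
      fix e f assume ef: "e \<in> M1" "f \<in> M1" "pl e = pl f"
      then have "pl e \<in> e \<inter> f" using pl(1)[OF ef(1)] pl(1)[OF ef(2)] by simp
      then show "e = f" using M1E(2) ef(1,2) unfolding disjoint_def by blast
    qed
    have "ln 2 * (\<Sum>e\<in>M1. \<omega> e * real (\<Sum>t<T. of_bool (price_violated b t e))) =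
        (\<Sum>e\<in>M1. ln 2 * \<omega> e * real (\<Sum>t<T. of_bool (price_violated b t e)))"
      by (simp add: sum_distrib_left mult.assoc)
    also have "\<dots> \<le> (\<Sum>e\<in>M1. \<omega> e * (1 + (k + 2) * ln n) + (\<Sum>t<T. sampled_violation b t (pl e)))"
      using player_violations_le[OF b(1)] pl M1E by (intro sum_mono) blast
    also have "\<dots> = ?O * (1 + (k + 2) * ln n) + (\<Sum>v\<in>pl ` M1. \<Sum>t<T. sampled_violation b t v)"
      using inj by (simp add: sum.distrib sum.reindex flip: sum_distrib_right)
    also have "(\<Sum>v\<in>pl ` M1. \<Sum>t<T. sampled_violation b t v) \<le> (\<Sum>v\<in>P. \<Sum>t<T. sampled_violation b t v)"
      using finP pl by (intro sum_mono2) (auto intro!: sum_nonneg simp: sampled_violation_def)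
    also have "\<dots> = (\<Sum>t<T. \<Sum>v\<in>P. sampled_violation b t v)" by (rule sum.swap)
    also have "\<dots> \<le> (\<Sum>t<T. \<eta> * ?O)"
    proof (rule sum_mono)
      fix t assume t: "t \<in> {..<T}"
      have "\<omega> e \<le> ?O" if "e \<in> E" for e using M1(2)[of "{e}"] that by (simp add: is_matching_def disjoint_def)
      moreover have "(1 - 4 * \<eta>) * ?O \<le> ?O" using \<eta> Opos by (simp add: mult_le_cancel_right1)
      moreover from this have "sum (board_prices b t) V \<le> ?O" using yV[of t] by linarith
      ultimately have "(\<Sum>v\<in>P. sampled_violation b t v) \<le> \<eta> ^ 3 / 4 * (4 * ?O / \<eta>\<^sup>2)"
        using b t \<eta> Opos by (intro sampled_violation_phase_le) auto
      then show "(\<Sum>v\<in>P. sampled_violation b t v) \<le> \<eta> * ?O"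
        using \<eta> by (simp add: field_simps power2_eq_square power3_eq_cube)
    qed
    also have "\<dots> = T * (\<eta> * ?O)" by simp
    finally have "ln 2 * (\<Sum>e\<in>M1. \<omega> e * real (\<Sum>t<T. of_bool (price_violated b t e)))
      \<le> ?O * (1 + (k + 2) * ln n) + T * (\<eta> * ?O)" by simp
    \<comment> \<open>With ln 2 \<ge> 2 / 3 the gain per phase is 4 / 3 * \<eta> against a loss of
      \<eta>; the net \<eta> / 3 explains the factor 3 in the lower bound on T.\<close>
    moreover have "2 / 3 * (2 * \<eta> * ?O * T) \<le> ln 2 * (\<Sum>e\<in>M1. \<omega> e * real (\<Sum>t<T. of_bool (price_violated b t e)))"
      using lower \<eta> Opos ln2_ge_two_thirds by (intro mult_mono) auto
    ultimately have "?O * (\<eta> * T / 3) \<le> ?O * (1 + (k + 2) * ln n)" by (simp add: algebra_simps)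
    then have "\<eta> * T / 3 \<le> 1 + (k + 2) * ln n" using Opos by simp
    then show False using T \<eta> by (simp add: field_simps)
  qed
  have "approx_max_weight_matching (8 * \<eta>) E w (best_matching \<eta> K (reports b))"
  proof (rule best_matching_approx[OF rep finE \<eta> w_pos window M0(1)])
    fix M' assume "is_matching E M'"
    then have "(1 - 5 * \<eta>) * sum \<omega> M' \<le> (1 - 5 * \<eta>) * ?O" using M1(2) \<eta> by (intro mult_left_mono) auto
    then show "(1 - 5 * \<eta>) * sum \<omega> M' \<le> sum \<omega> M0" using main by simp
  qed
  then show ?thesis by (simp add: protocol_def)
qed

lemma prob_outcome:
  defines "x \<equiv> N * r * (\<eta> ^ 3 / 4)"
  shows "measure_pmf.prob (board (N * T)) {b. approx_max_weight_matching (8 * \<eta>) E w (outcome protocol b)}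
    \<ge> 1 - T * (card E * (exp (- x) * exp (n * Z * exp (- x))))"
proof -
  let ?p = "board (N * T)" and ?bad = "bad_run (\<eta> ^ 3 / 4)"
  have "1 - measure_pmf.prob ?p ?bad = measure_pmf.prob ?p (UNIV - ?bad)"
    using measure_pmf.prob_compl[of ?bad ?p] by simp
  also have "\<dots> \<le> measure_pmf.prob ?p {b. approx_max_weight_matching (8 * \<eta>) E w (outcome protocol b)}"
    using good_run_outcome
    by (intro measure_pmf.finite_measure_mono_AE) (auto simp: AE_measure_pmf_iff)
  finally show ?thesis using prob_bad_run_le[of "\<eta> ^ 3 / 4"] \<eta> unfolding x_def by simp
qed

end

section \<open>Parameters\<close>

text \<open>Blocks are encoded by counting, all with the same positive length, so the empty string
  stays free to mean no report.\<close>

lemma exists_block_code: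
  assumes X: "finite X" "card X \<le> 2 ^ q" and qr: "1 \<le> q" "1 \<le> r"
  obtains enc :: "'x list \<Rightarrow> bool list" and dec where
    "\<And>es. length (enc es) = q * r" "\<And>es. length es = r \<Longrightarrow> set es \<subseteq> X \<Longrightarrow> dec (enc es) = es" "dec [] = []"
proof -
  let ?Y = "{es. set es \<subseteq> X \<and> length es = r}" and ?B = "{s :: bool list. set s \<subseteq> UNIV \<and> length s = q * r}"
  have "card ?Y = card X ^ r" using X by (intro card_lists_length_eq)
  also have "\<dots> \<le> (2 ^ q) ^ r" using X by (intro power_mono) auto
  also have "\<dots> = card ?B" by (subst card_lists_length_eq) (auto simp: power_mult)
  finally have "card ?Y \<le> card ?B" .
  moreover have "finite ?Y" "finite ?B" using X(1) finite_lists_length_eq[of "UNIV :: bool set"]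
    by (simp_all add: finite_lists_length_eq)
  ultimately obtain f where f: "inj_on f ?Y" "f ` ?Y \<subseteq> ?B"
    using inj_on_iff_card_le[of ?Y ?B] by blast
  define enc where "enc es = (if es \<in> ?Y then f es else replicate (q * r) False)" for es
  define dec where "dec s = (if s = [] then [] else inv_into ?Y f s)" for s
  have len: "length (enc es) = q * r" for es using f(2) by (auto simp: enc_def)
  then have ne: "enc es \<noteq> []" for es using qr by (metis length_0_conv mult_is_0 not_one_le_zero)
  show thesis
  proof (rule that[of enc dec])
    fix es assume "length es = r" "set es \<subseteq> X"
    then have "es \<in> ?Y" by simp
    then show "dec (enc es) = es" using f(1) ne[of es] by (simp add: dec_def enc_def)
  qed (use len in \<open>auto simp: dec_def\<close>)
qed

lemma le_power_self: "2 \<le> n \<Longrightarrow> real a \<le> real n ^ a"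
proof -
  assume n: "2 \<le> n"
  have "real a \<le> 2 ^ a" using of_nat_less_two_power[of a] by (simp add: less_imp_le)
  also have "\<dots> \<le> real n ^ a" using n by (intro power_mono) auto
  finally show ?thesis .
qed

lemma ln_nat_bounds:
  assumes "2 \<le> n"
  shows "2 / 3 \<le> ln (real n)" "ln (real n) \<le> n"
proof -
  have "ln 2 \<le> ln (real n)" using assms by simp
  then show "2 / 3 \<le> ln (real n)" using ln2_ge_two_thirds by linarith
  show "ln (real n) \<le> n" using ln_le_minus_one[of "real n"] assms by simp
qed

definition class_spread :: "nat \<Rightarrow> nat \<Rightarrow> real \<Rightarrow> nat" where
  "class_spread k n \<eta> = nat \<lceil>real k * ln n / ln (1 + \<eta>) + 1\<rceil>"

lemma class_spread_ge: "real k * ln n / ln (1 + \<eta>) + 1 \<le> class_spread k n \<eta>"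
  unfolding class_spread_def by linarith

lemma class_spread_le:
  assumes n: "2 \<le> n" and \<eta>: "0 < \<eta>" "\<eta> \<le> 1"
  shows "real (2 * class_spread k n \<eta> + 1) \<le> real (4 * k + 8) * ln n / \<eta>"
proof -
  note l = ln_nat_bounds[OF n]
  have "\<eta> / 2 \<le> \<eta> / (1 + \<eta>)" using \<eta> by (simp add: field_simps)
  also have "\<dots> \<le> ln (1 + \<eta>)"
    using ln_le_minus_one[of "1 / (1 + \<eta>)"] \<eta> by (simp add: ln_div field_simps)
  finally have ln\<eta>: "\<eta> / 2 \<le> ln (1 + \<eta>)" .
  then have "real k * ln n / ln (1 + \<eta>) \<le> real k * ln n / (\<eta> / 2)"
    using \<eta> l by (intro divide_left_mono mult_pos_pos) auto
  then have "real k * ln n / ln (1 + \<eta>) \<le> 2 * (k * ln n / \<eta>)" by (simp add: mult.commute)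
  moreover have "0 \<le> real k * ln n / ln (1 + \<eta>)" using l \<eta> by (intro divide_nonneg_pos mult_nonneg_nonneg) auto
  then have "real (class_spread k n \<eta>) \<le> real k * ln n / ln (1 + \<eta>) + 2"
    unfolding class_spread_def by linarith
  ultimately have spread: "real (class_spread k n \<eta>) \<le> 2 * (k * ln n / \<eta>) + 2" by linarith
  have "1 * (2 / 3) \<le> 1 / \<eta> * ln n" using \<eta> l by (intro mult_mono) auto
  \<comment> \<open>Absorbs the additive 4 + 1 left by twice the spread plus one; ln n / \<eta>
    \<ge> 2 / 3 suffices.\<close>
  then have "5 \<le> 8 * ln n / \<eta>" by simp
  with spread have "real (2 * class_spread k n \<eta> + 1) \<le> 4 * (k * ln n / \<eta>) + 8 * ln n / \<eta>" by simp
  also have "\<dots> = real (4 * k + 8) * ln n / \<eta>" using \<eta> by (simp add: field_simps)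
  finally show ?thesis .
qed

lemma card_edge_residues_le:
  assumes "finite P" "finite Q" "n = card (P \<union> Q)"
  shows "card (edge_residues P Q K) \<le> n ^ 2 * (2 * K + 1)"
proof -
  have "card P \<le> n" "card Q \<le> n" using assms by (auto intro: card_mono)
  then have "card P * card Q * (2 * K + 1) \<le> n ^ 2 * (2 * K + 1)"
    unfolding power2_eq_square by (intro mult_le_mono) auto
  then show ?thesis using finite_edge_residues(2)[OF assms(1,2), of K] by linarith
qed

lemma card_bipartite_edges_le:
  assumes E: "bipartite_graph P Q E" and n: "n = card (P \<union> Q)"
  shows "card E \<le> n ^ 2"
proof -
  have fin: "finite P" "finite Q" using E by (auto simp: bipartite_graph_def)
  \<comment> \<open>For K = 0 the only residue is 0, so the count of reports becomes a count of
    edges.\<close>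
  have "inj_on (\<lambda>e. (e, 0 :: int)) E" by (simp add: inj_on_def)
  then have "card E = card ((\<lambda>e. (e, 0 :: int)) ` E)" by (simp add: card_image)
  also have "\<dots> \<le> card (edge_residues P Q 0)"
    using E finite_edge_residues(1)[OF fin, of 0]
    by (intro card_mono) (auto simp: edge_residues_def bipartite_graph_def)
  also have "\<dots> \<le> n ^ 2" using card_edge_residues_le[OF fin n, of 0] by simp
  finally show ?thesis .
qed

text \<open>For \<open>\<epsilon> < 1 / n\<close> there is enough time to report all edges.\<close>

lemma protocol_small_epsilon:
  assumes fin: "finite P" "finite Q" and n: "n = card (P \<union> Q)" "2 \<le> n"
    and \<epsilon>: "0 < \<epsilon>" "\<epsilon> < 1 / real n"
  shows "\<exists>\<pi>. real (rounds \<pi>) \<le> real (32 * k + 64) * ln n / \<epsilon> ^ 7 \<and>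
    (\<forall>v x b. \<forall>m\<in>set_pmf (message \<pi> v x b). length m = 1) \<and>
    (\<forall>E w. bipartite_graph P Q E \<longrightarrow> poly_weights k n E w \<longrightarrow>
      measure_pmf.prob (blackboard_after P \<pi> (incident_edges E w) (rounds \<pi>))
        {b. approx_max_weight_matching \<epsilon> E w (outcome \<pi> b)} = 1)"
proof -
  define \<eta> where "\<eta> = \<epsilon> / 8"
  have "1 / real n \<le> 1" using n by simp
  then have \<epsilon>1: "\<epsilon> < 1" using \<epsilon> by linarith
  have \<eta>: "0 < \<eta>" "8 * \<eta> \<le> 1" "\<eta> \<le> 1" "8 * \<eta> = \<epsilon>" using \<epsilon> \<epsilon>1 by (auto simp: \<eta>_def)
  let ?K = "class_spread k n \<eta>"
  obtain xs where xs: "set xs = edge_residues P Q ?K" "distinct xs"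
    using finite_distinct_list[OF finite_edge_residues(1)[OF fin]] by blast
  let ?\<pi> = "bitwise_protocol P \<eta> ?K xs"
  have "real (rounds ?\<pi>) = card (edge_residues P Q ?K)"
    using xs by (simp add: bitwise_protocol_def distinct_card[symmetric])
  also have "\<dots> \<le> real n ^ 2 * real (2 * ?K + 1)"
    using card_edge_residues_le[OF fin n(1), of ?K] by (metis of_nat_le_iff of_nat_mult of_nat_power)
  \<comment> \<open>Here n < 1 / \<epsilon> is used: n^2 pairs with O(ln n / \<epsilon>) residues
    each give O(ln n / \<epsilon>^3) rounds.\<close>
  also have "\<dots> \<le> (1 / \<epsilon>) ^ 2 * (real (4 * k + 8) * ln n / \<eta>)"
  proof (intro mult_mono power_mono)
    show "real n \<le> 1 / \<epsilon>" using \<epsilon> n by (simp add: field_simps)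
    show "real (2 * ?K + 1) \<le> real (4 * k + 8) * ln n / \<eta>"
      by (rule class_spread_le[OF n(2) \<eta>(1,3)])
  qed (use \<epsilon> in auto)
  also have "\<dots> = real (32 * k + 64) * ln n / \<epsilon> ^ 3"
    using \<epsilon> by (simp add: \<eta>_def field_simps power2_eq_square power3_eq_cube)
  also have "\<dots> \<le> real (32 * k + 64) * ln n / \<epsilon> ^ 7"
  proof (intro divide_left_mono)
    show "\<epsilon> ^ 7 \<le> \<epsilon> ^ 3" using \<epsilon> \<epsilon>1 by (intro power_decreasing) auto
  qed (use \<epsilon> n in auto)
  finally have rounds: "real (rounds ?\<pi>) \<le> real (32 * k + 64) * ln n / \<epsilon> ^ 7" .
  have "measure_pmf.prob (blackboard_after P ?\<pi> (incident_edges E w) (rounds ?\<pi>))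
        {b. approx_max_weight_matching \<epsilon> E w (outcome ?\<pi> b)} = 1"
    if E: "bipartite_graph P Q E" "poly_weights k n E w" for E w
  proof -
    have "approx_max_weight_matching (8 * \<eta>) E w (outcome ?\<pi> b)"
      if "b \<in> set_pmf (blackboard_after P ?\<pi> (incident_edges E w) (rounds ?\<pi>))" for b
      using that n by (intro bitwise_protocol_outcome[OF E(1) \<eta>(1,2) _ E(2) class_spread_ge xs(1)])
        (auto simp: bitwise_protocol_def)
    then show ?thesis unfolding \<eta>(4) by (subst measure_pmf.prob_eq_1) (auto simp: AE_measure_pmf_iff)
  qed
  then show ?thesis using rounds by (intro exI[of _ ?\<pi>]) (auto simp: bitwise_protocol_def)
qed

text \<open>About ln n samples per message at O(ln n) bits each; N is of order q / \<eta>^3, so the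
  failure exponent N * r * \<eta>^3 / 4 reaches q * ln n; T is of order ln n / \<eta>. The exponent
  q pays for the phases (24 * k + 98), the edges (2), the factor from the level vectors (2) and the
  failure probability (c). The alphabet of reports has at most n^d elements.\<close>

lemma protocol_large_epsilon:
  fixes k c :: nat
  defines "q \<equiv> 24 * k + 102 + c" and "d \<equiv> 32 * k + 68"
  assumes fin: "finite P" "finite Q" and n: "n = card (P \<union> Q)" "2 \<le> n"
    and \<epsilon>: "1 / real n \<le> \<epsilon>" "\<epsilon> < 1"
  shows "\<exists>\<pi>. real (rounds \<pi>) \<le> real (5 * q * (3 * k + 12) * 8 ^ 4) * ln n / \<epsilon> ^ 7 \<and>
    (\<forall>v x b. \<forall>m\<in>set_pmf (message \<pi> v x b). real (length m) \<le> real (8 * d) * (ln n)\<^sup>2) \<and>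
    (\<forall>E w. bipartite_graph P Q E \<longrightarrow> poly_weights k n E w \<longrightarrow>
      measure_pmf.prob (blackboard_after P \<pi> (incident_edges E w) (rounds \<pi>))
        {b. approx_max_weight_matching \<epsilon> E w (outcome \<pi> b)} \<ge> 1 - 1 / real n ^ c)"
proof -
  define \<eta> where "\<eta> = \<epsilon> / 8"
  note l = ln_nat_bounds[OF n(2)]
  have "0 < 1 / real n" using n(2) by simp
  then have \<epsilon>0: "0 < \<epsilon>" using \<epsilon>(1) by linarith
  have \<eta>: "0 < \<eta>" "8 * \<eta> \<le> 1" "\<eta> \<le> 1" "8 * \<eta> = \<epsilon>" using \<epsilon> \<epsilon>0 by (auto simp: \<eta>_def)
  have inv\<eta>: "1 / \<eta> \<le> 8 * n" using \<epsilon> \<epsilon>0 n by (simp add: \<eta>_def field_simps)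
  let ?K = "class_spread k n \<eta>"
  define r where "r = nat \<lceil>ln (real n)\<rceil>"
  define N where "N = nat \<lceil>4 * q / \<eta> ^ 3\<rceil>"
  define T where "T = nat \<lfloor>3 * (1 + real (k + 2) * ln n) / \<eta>\<rfloor> + 1"
  define Z where "Z = nat \<lceil>1 / \<eta>\<rceil>"
  define l2 where "l2 = nat \<lceil>log 2 n\<rceil>"
  have l\<eta>: "ln n / \<eta> \<le> 8 * real n ^ 2"
  proof -
    have "ln n * (1 / \<eta>) \<le> real n * (8 * n)" using l inv\<eta> \<eta> by (intro mult_mono) auto
    then show ?thesis by (simp add: power2_eq_square)
  qed
  have r: "1 \<le> r" "ln n \<le> r" "r \<le> 5 / 2 * ln n" using l unfolding r_def by linarith+
  have q1: "1 \<le> q" by (simp add: q_def)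
  have q\<eta>: "1 \<le> real q / \<eta> ^ 3"
  proof -
    have "\<eta> ^ 3 \<le> 1" using \<eta> by (intro power_le_one) auto
    then show ?thesis using q1 \<eta> by (simp add: field_simps)
  qed
  have N: "1 \<le> N" "4 * q / \<eta> ^ 3 \<le> N" "N \<le> 5 * q / \<eta> ^ 3"
    using q\<eta> unfolding N_def by linarith+
  have \<eta>l: "2 / 3 \<le> ln n / \<eta>"
  proof -
    have "1 * (2 / 3) \<le> 1 / \<eta> * ln n" using \<eta> l by (intro mult_mono) auto
    then show ?thesis by simp
  qed
  have T: "3 * (1 + real (k + 2) * ln n) / \<eta> < T" "T \<le> real (3 * k + 12) * ln n / \<eta>"
  proof -
    have nonneg: "0 \<le> 3 * (1 + real (k + 2) * ln n) / \<eta>" using l \<eta> by auto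
    then show "3 * (1 + real (k + 2) * ln n) / \<eta> < T" unfolding T_def by linarith
    have "T \<le> 3 * (1 + real (k + 2) * ln n) / \<eta> + 1" using nonneg unfolding T_def by linarith
    also have "\<dots> \<le> 3 * (3 / 2 * ln n + real (k + 2) * ln n) / \<eta> + 3 / 2 * (ln n / \<eta>)"
      using l \<eta> \<eta>l by (intro add_mono divide_right_mono mult_left_mono) auto
    also have "\<dots> = real (3 * k + 12) * ln n / \<eta>" using \<eta> by (simp add: field_simps)
    finally show "T \<le> real (3 * k + 12) * ln n / \<eta>" .
  qed
  have Z: "1 \<le> \<eta> * Z" "Z \<le> 8 * n"
  proof -
    have "1 / \<eta> \<le> Z" unfolding Z_def by linarith
    then show "1 \<le> \<eta> * Z" using \<eta> by (simp add: field_simps)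
    show "Z \<le> 8 * n" using inv\<eta> unfolding Z_def by (simp add: ceiling_le_iff nat_le_iff)
  qed
  have l2: "real n \<le> 2 ^ l2" "l2 \<le> 3 * ln n" "1 \<le> l2"
  proof -
    have log: "1 \<le> log 2 n" using n by (simp add: le_log_iff)
    have le: "log 2 n \<le> l2" unfolding l2_def by linarith
    have "real n = 2 powr log 2 n" using n by simp
    also have "\<dots> \<le> 2 powr l2" using le by (intro powr_mono) auto
    finally show "real n \<le> 2 ^ l2" by (simp add: powr_realpow)
    have "log 2 n \<le> ln n / (2 / 3)"
      unfolding log_def using l ln2_ge_two_thirds by (intro divide_left_mono) auto
    then have "log 2 n \<le> 3 / 2 * ln n" by simp
    then show "l2 \<le> 3 * ln n" using l log unfolding l2_def by linarith
    show "1 \<le> l2" using log le by linarith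
  qed
  have card: "card (edge_residues P Q ?K) \<le> 2 ^ (d * l2)"
  proof -
    have "real (card (edge_residues P Q ?K)) \<le> real n ^ 2 * real (2 * ?K + 1)"
      using card_edge_residues_le[OF fin n(1), of ?K] by (metis of_nat_le_iff of_nat_mult of_nat_power)
    also have "\<dots> \<le> real n ^ 2 * (real (4 * k + 8) * (8 * real n ^ 2))"
    proof (intro mult_left_mono)
      have "real (2 * ?K + 1) \<le> real (4 * k + 8) * (ln n / \<eta>)" using class_spread_le[OF n(2) \<eta>(1,3), of k] by simp
      also have "\<dots> \<le> real (4 * k + 8) * (8 * real n ^ 2)" by (intro mult_left_mono l\<eta>) auto
      finally show "real (2 * ?K + 1) \<le> real (4 * k + 8) * (8 * real n ^ 2)" .
    qed auto
    also have "\<dots> = real (32 * k + 64) * real n ^ 4" by (simp add: algebra_simps flip: power_add)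
    also have "\<dots> \<le> real n ^ (32 * k + 64) * real n ^ 4"
      by (intro mult_right_mono le_power_self n(2)) auto
    also have "\<dots> = real n ^ d" by (simp add: d_def add.commute flip: power_add)
    also have "\<dots> \<le> (2 ^ l2) ^ d" using l2 by (intro power_mono) auto
    also have "\<dots> = 2 ^ (d * l2)" by (simp add: power_mult[symmetric] mult.commute)
    finally have "real (card (edge_residues P Q ?K)) \<le> real (2 ^ (d * l2))" by simp
    then show ?thesis by (simp only: of_nat_le_iff)
  qed
  have "1 \<le> d * l2" using l2 by (simp add: d_def)
  then obtain enc :: "('a set \<times> int) list \<Rightarrow> bool list" and dec where code: "\<And>es. length (enc es) = d * l2 * r"
    "\<And>es. length es = r \<Longrightarrow> set es \<subseteq> edge_residues P Q ?K \<Longrightarrow> dec (enc es) = es" "dec [] = []"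
    using exists_block_code[OF finite_edge_residues(1)[OF fin] card _ r(1)] by blast
  interpret sp: sampling_protocol P Q k n ?K r N T Z \<eta> enc dec
    by unfold_locales (use fin n \<eta> class_spread_ge r N Z T code in auto)
  have "real (rounds sp.protocol) = real N * real T" by (simp add: sp.protocol_def)
  also have "\<dots> \<le> (5 * q / \<eta> ^ 3) * (real (3 * k + 12) * ln n / \<eta>)"
    using N T \<eta> by (intro mult_mono) auto
  also have "\<dots> = real (5 * q * (3 * k + 12) * 8 ^ 4) * ln n / \<epsilon> ^ 4"
  proof -
    have "(5 * q / \<eta> ^ 3) * (real (3 * k + 12) * ln n / \<eta>) = real (5 * q * (3 * k + 12)) * ln n / \<eta> ^ 4"
      by (simp add: power3_eq_cube power4_eq_xxxx)
    also have "\<eta> ^ 4 = \<epsilon> ^ 4 / 8 ^ 4" by (simp add: \<eta>_def power_divide)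
    finally show ?thesis by simp
  qed
  also have "\<dots> \<le> real (5 * q * (3 * k + 12) * 8 ^ 4) * ln n / \<epsilon> ^ 7"
  proof (intro divide_left_mono)
    show "\<epsilon> ^ 7 \<le> \<epsilon> ^ 4" using \<epsilon> \<epsilon>0 by (intro power_decreasing) auto
  qed (use \<epsilon>0 l in auto)
  finally have rounds: "real (rounds sp.protocol) \<le> real (5 * q * (3 * k + 12) * 8 ^ 4) * ln n / \<epsilon> ^ 7" .
  have bits: "real (length m) \<le> real (8 * d) * (ln n)\<^sup>2" if m: "m \<in> set_pmf (message sp.protocol v x b)" for v x b m
  proof -
    have "length m \<le> d * l2 * r" using m by (auto simp: sp.protocol_def sp.sample_message_def code(1) split: if_splits)
    then have "real (length m) \<le> real d * (real l2 * real r)"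
      by (metis mult.assoc of_nat_le_iff of_nat_mult)
    also have "\<dots> \<le> real d * ((3 * ln n) * (5 / 2 * ln n))"
      using l2 r l by (intro mult_left_mono mult_mono) auto
    also have "\<dots> \<le> real (8 * d) * (ln n)\<^sup>2" by (simp add: power2_eq_square)
    finally show ?thesis .
  qed
  have "measure_pmf.prob (blackboard_after P sp.protocol (incident_edges E w) (rounds sp.protocol))
        {b. approx_max_weight_matching \<epsilon> E w (outcome sp.protocol b)} \<ge> 1 - 1 / real n ^ c"
    if Ew: "bipartite_graph P Q E" "poly_weights k n E w" for E w
  proof -
    interpret sr: sampling_run P Q k n ?K r N T Z \<eta> enc dec E w
      by unfold_locales (use Ew in auto)
    define x where "x = N * r * (\<eta> ^ 3 / 4)"
    have "q * ln n \<le> (N * (\<eta> ^ 3 / 4)) * r"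
      using N r l \<eta> by (intro mult_mono) (auto simp: field_simps)
    then have "exp (- x) \<le> exp (- (q * ln n))" by (simp add: x_def mult_ac)
    also have "\<dots> = 1 / real n ^ q" using n by (simp add: exp_minus exp_of_nat_mult inverse_eq_divide)
    finally have ex: "exp (- x) \<le> 1 / real n ^ q" .
    have T': "real T \<le> real n ^ (24 * k + 98)"
    proof -
      have "real T \<le> real (3 * k + 12) * (ln n / \<eta>)" using T by simp
      also have "\<dots> \<le> real (3 * k + 12) * (8 * real n ^ 2)" by (intro mult_left_mono l\<eta>) auto
      also have "\<dots> = real (24 * k + 96) * real n ^ 2" by (simp add: algebra_simps)
      also have "\<dots> \<le> real n ^ (24 * k + 96) * real n ^ 2"
        by (intro mult_right_mono le_power_self n(2)) auto
      finally show ?thesis by (simp add: add.commute flip: power_add)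
    qed
    have E': "real (card E) \<le> real n ^ 2"
      using card_bipartite_edges_le[OF Ew(1) n(1)] by (metis of_nat_le_iff of_nat_power)
    \<comment> \<open>Since n * Z \<le> n^5 \<le> n^q, the exponent is at most 1, and exp 1 \<le> 4
      \<le> n^2.\<close>
    have e': "exp (n * Z * exp (- x)) \<le> real n ^ 2"
    proof -
      have "real (n * Z) \<le> real n * (8 * n)" using Z(2) by (simp add: mult_left_mono)
      also have "\<dots> = 2 ^ 3 * real n ^ 2" by (simp add: power2_eq_square)
      also have "\<dots> \<le> real n ^ 3 * real n ^ 2" using n by (intro mult_right_mono power_mono) auto
      also have "\<dots> \<le> real n ^ q" using n by (simp add: q_def flip: power_add)
      finally have "real (n * Z) * exp (- x) \<le> real n ^ q * (1 / real n ^ q)"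
        using ex by (intro mult_mono) auto
      also have "\<dots> = 1" using n by simp
      finally have "exp (n * Z * exp (- x)) \<le> exp 1" by simp
      also have "\<dots> \<le> 2 ^ 2" using exp_le by simp
      also have "\<dots> \<le> real n ^ 2" using n by (intro power_mono) auto
      finally show ?thesis .
    qed
    have "T * (card E * (exp (- x) * exp (n * Z * exp (- x)))) \<le>
        real n ^ (24 * k + 98) * (real n ^ 2 * (1 / real n ^ q * real n ^ 2))"
      using T' E' ex e' by (intro mult_mono) auto
    also have "\<dots> = 1 / real n ^ c" using n by (simp add: q_def field_simps flip: power_add)
    finally show ?thesis
      using sr.prob_outcome unfolding \<eta>(4) x_def by (simp add: sp.protocol_def)
  qed
  then show ?thesis using rounds bits by (intro exI[of _ sp.protocol]) blast
qed

section \<open>Trivial cases and assembly of both bounds\<close>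

lemma bipartite_graph_sym: "bipartite_graph L R E \<Longrightarrow> bipartite_graph R L E"
  unfolding bipartite_graph_def by (auto simp: insert_commute subset_iff) (metis insert_commute)+

lemma mwm_protocol_mono:
  assumes "mwm_protocol L R k \<epsilon> \<delta> T B S \<pi>" "T \<le> T'" "B \<le> B'"
  shows "mwm_protocol L R k \<epsilon> \<delta> T' B' S \<pi>"
  using assms unfolding mwm_protocol_def by (meson order_trans)

text \<open>With fewer than two vertices \<open>ln n\<close> is 0 and the bounds permit no
  communication, but then there are no edges. For \<epsilon> \<ge> 1 the empty matching is good
  enough.\<close>

lemma mwm_protocol_silent:
  assumes fin: "finite L" "finite R" and triv: "1 \<le> \<epsilon> \<or> card (L \<union> R) < 2"
    and bounds: "0 \<le> T" "0 \<le> B" "0 \<le> S" "0 \<le> \<delta>"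
  shows "\<exists>\<pi>. mwm_protocol L R k \<epsilon> \<delta> T B S \<pi>"
proof -
  let ?\<pi> = "\<lparr>rounds = 0, message = \<lambda>_ _ _. return_pmf [], outcome = \<lambda>_. {}\<rparr> :: 'a protocol"
  have "approx_max_weight_matching \<epsilon> E w {}"
    if E: "bipartite_graph L R E" and w: "poly_weights k (card (L \<union> R)) E w" for E w
  proof -
    have finE: "finite E" by (rule bipartite_graph_finite[OF E])
    have empty: "is_matching E {}" by (simp add: is_matching_def disjoint_def)
    obtain M where M: "is_matching E M" "\<And>M'. is_matching E M' \<Longrightarrow> sum w M' \<le> sum w M"
      using exists_best_matching[OF finE, of w] by blast
    have mmw: "max_matching_weight E w = sum w M"
      unfolding max_matching_weight_def using M finite_matchings[OF finE] by (intro Max_eqI) auto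
    have "(1 - \<epsilon>) * sum w M \<le> 0"
    proof (cases "1 \<le> \<epsilon>")
      case True
      then show ?thesis using M(2)[OF empty] by (simp add: mult_nonpos_nonneg)
    next
      case False
      have "E = {}"
      proof (rule ccontr)
        assume "E \<noteq> {}"
        then obtain e where e: "e \<in> E" by blast
        have "card e = 2" by (rule bipartite_edgeE[OF E e]) auto
        moreover have "card e \<le> card (L \<union> R)"
          using bipartite_edge_subset(1)[OF E e] fin by (intro card_mono) auto
        ultimately show False using triv False by simp
      qed
      then show ?thesis using M(1) by (simp add: is_matching_def)
    qed
    then show ?thesis using empty mmw by (simp add: approx_max_weight_matching_def)
  qed
  then have "mwm_protocol L R k \<epsilon> \<delta> T B S ?\<pi>"
    using fin bounds by (intro mwm_protocolI) (auto simp: smaller_side_def run_def indicator_def)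
  then show ?thesis by blast
qed

theorem theorem4:
  fixes k c :: nat
  shows "\<exists>C>0. \<forall>(L :: 'v set) (R :: 'v set) (\<epsilon> :: real) (n :: nat).
    finite L \<and> finite R \<and> L \<inter> R = {} \<and> n = card (L \<union> R) \<and> 0 < \<epsilon> \<longrightarrow>
      (\<exists>\<pi>. mwm_protocol L R k \<epsilon> (1 / real n ^ c)
             (C * ln (real n) / \<epsilon> ^ 7)
             (C * (ln (real n))\<^sup>2 / \<epsilon>)
             (C * (real n * ln (real n) ^ 3 / \<epsilon> ^ 8)) \<pi>) \<and>
      (\<exists>\<pi>. mwm_protocol L R k \<epsilon> (1 / real n ^ c)
             (C * ln (real n) / \<epsilon> ^ 8)
             (C * (ln (real n))\<^sup>2)
             (C * (real n * ln (real n) ^ 3 / \<epsilon> ^ 8)) \<pi>)"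
proof -
  define A :: real where "A = real (32 * k + 64) + real (5 * (24 * k + 102 + c) * (3 * k + 12) * 8 ^ 4)"
  define D :: real where "D = real (8 * (32 * k + 68))"
  \<comment> \<open>Rounds need A, message lengths D, and the total communication their
    product.\<close>
  define C where "C = A + D + A * D"
  have AD: "0 < A" "3 \<le> D" unfolding A_def by (intro add_pos_nonneg) (auto simp: D_def)
  then have "0 < A * D" by simp
  with AD have C: "0 < C" "A \<le> C" "D \<le> C" "A * D \<le> C" unfolding C_def by linarith+
  show ?thesis
  proof (intro exI[of _ C] conjI C(1) allI impI)
    fix L R :: "'v set" and \<epsilon> :: real and n :: nat
    assume asm: "finite L \<and> finite R \<and> L \<inter> R = {} \<and> n = card (L \<union> R) \<and> 0 < \<epsilon>"
    then have fin: "finite L" "finite R" and n: "n = card (L \<union> R)" and \<epsilon>: "0 < \<epsilon>" by auto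
    have l0: "0 \<le> ln (real n)" by (cases "n = 0") auto
    let ?T = "C * ln (real n) / \<epsilon> ^ 7" and ?B = "C * (ln (real n))\<^sup>2"
      and ?S = "C * (real n * ln (real n) ^ 3 / \<epsilon> ^ 8)"
    have "(\<exists>\<pi>. mwm_protocol L R k \<epsilon> (1 / real n ^ c) ?T (?B / \<epsilon>) ?S \<pi>) \<and>
      (\<exists>\<pi>. mwm_protocol L R k \<epsilon> (1 / real n ^ c) (C * ln (real n) / \<epsilon> ^ 8) ?B ?S \<pi>)"
    proof (cases "1 \<le> \<epsilon> \<or> n < 2")
      case True
      then show ?thesis
        using fin n \<epsilon> C l0 by (intro conjI mwm_protocol_silent) auto
    next
      case False
      then have \<epsilon>1: "\<epsilon> < 1" and n2: "2 \<le> n" by auto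
      note l = ln_nat_bounds[OF n2]
      let ?P = "smaller_side L R"
      obtain Q where Q: "finite ?P" "finite Q" "n = card (?P \<union> Q)" "card ?P \<le> n"
        "\<And>E. bipartite_graph L R E \<Longrightarrow> bipartite_graph ?P Q E"
      proof (cases "card L \<le> card R")
        case True
        then show thesis using that[of R] fin n by (auto simp: smaller_side_def intro: card_mono)
      next
        case False
        then show thesis using that[of L] fin n bipartite_graph_sym
          by (auto simp: smaller_side_def Un_commute intro: card_mono)
      qed
      have "\<exists>\<pi>. real (rounds \<pi>) \<le> A * ln n / \<epsilon> ^ 7 \<and>
        (\<forall>v x b. \<forall>m\<in>set_pmf (message \<pi> v x b). real (length m) \<le> D * (ln n)\<^sup>2) \<and>
        (\<forall>E w. bipartite_graph ?P Q E \<longrightarrow> poly_weights k n E w \<longrightarrow>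
          measure_pmf.prob (blackboard_after ?P \<pi> (incident_edges E w) (rounds \<pi>))
            {b. approx_max_weight_matching \<epsilon> E w (outcome \<pi> b)} \<ge> 1 - 1 / real n ^ c)"
      proof (cases "\<epsilon> < 1 / real n")
        case True
        \<comment> \<open>One-bit messages must fit the common length bound, which holds by ln n
          \<ge> 2 / 3 and D \<ge> 3.\<close>
        have "(2 / 3)\<^sup>2 \<le> (ln (real n))\<^sup>2" using l by (intro power_mono) auto
        then have "3 * (2 / 3)\<^sup>2 \<le> D * (ln (real n))\<^sup>2" using AD by (intro mult_mono) auto
        then have D1: "1 \<le> D * (ln (real n))\<^sup>2" by (simp add: power2_eq_square)
        have "real (32 * k + 64) * ln n / \<epsilon> ^ 7 \<le> A * ln n / \<epsilon> ^ 7"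
          using l \<epsilon> by (intro divide_right_mono mult_right_mono) (auto simp: A_def)
        moreover from protocol_small_epsilon[OF Q(1-3) n2 \<epsilon> True, of k] obtain \<pi> where
          "real (rounds \<pi>) \<le> real (32 * k + 64) * ln n / \<epsilon> ^ 7"
          "\<forall>v x b. \<forall>m\<in>set_pmf (message \<pi> v x b). length m = 1"
          "\<forall>E w. bipartite_graph ?P Q E \<longrightarrow> poly_weights k n E w \<longrightarrow>
            measure_pmf.prob (blackboard_after ?P \<pi> (incident_edges E w) (rounds \<pi>))
              {b. approx_max_weight_matching \<epsilon> E w (outcome \<pi> b)} = 1" by blast
        ultimately show ?thesis using D1 by (intro exI[of _ \<pi>]) auto
      next
        case large: False
        have "real (5 * (24 * k + 102 + c) * (3 * k + 12) * 8 ^ 4) * ln n / \<epsilon> ^ 7 \<le> A * ln n / \<epsilon> ^ 7"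
          using l \<epsilon> by (intro divide_right_mono mult_right_mono) (auto simp: A_def)
        moreover from protocol_large_epsilon[OF Q(1-3) n2 _ \<epsilon>1, of k c] large obtain \<pi> where
          "real (rounds \<pi>) \<le> real (5 * (24 * k + 102 + c) * (3 * k + 12) * 8 ^ 4) * ln n / \<epsilon> ^ 7"
          "\<forall>v x b. \<forall>m\<in>set_pmf (message \<pi> v x b). real (length m) \<le> D * (ln n)\<^sup>2"
          "\<forall>E w. bipartite_graph ?P Q E \<longrightarrow> poly_weights k n E w \<longrightarrow>
            measure_pmf.prob (blackboard_after ?P \<pi> (incident_edges E w) (rounds \<pi>))
              {b. approx_max_weight_matching \<epsilon> E w (outcome \<pi> b)} \<ge> 1 - 1 / real n ^ c"
          unfolding D_def not_less by blast
        ultimately show ?thesis by (intro exI[of _ \<pi>] conjI) (blast intro: order_trans)+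
      qed
      then obtain \<pi> where \<pi>: "real (rounds \<pi>) \<le> A * ln n / \<epsilon> ^ 7"
        "\<And>v x b m. m \<in> set_pmf (message \<pi> v x b) \<Longrightarrow> real (length m) \<le> D * (ln n)\<^sup>2"
        "\<And>E w. bipartite_graph ?P Q E \<Longrightarrow> poly_weights k n E w \<Longrightarrow>
          measure_pmf.prob (blackboard_after ?P \<pi> (incident_edges E w) (rounds \<pi>))
            {b. approx_max_weight_matching \<epsilon> E w (outcome \<pi> b)} \<ge> 1 - 1 / real n ^ c"
        by blast
      \<comment> \<open>As \<epsilon> < 1, both variants are weakenings of the bounds for this one
        protocol.\<close>
      have pow: "1 / \<epsilon> ^ 7 \<le> 1 / \<epsilon> ^ 8" using \<epsilon> \<epsilon>1 by (intro divide_left_mono power_decreasing) auto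
      have "mwm_protocol L R k \<epsilon> (1 / real n ^ c) (A * ln n / \<epsilon> ^ 7) (D * (ln n)\<^sup>2) ?S \<pi>"
      proof (rule mwm_protocolI)
        have "real (rounds \<pi>) * (card ?P * (D * (ln n)\<^sup>2)) \<le> (A * ln n / \<epsilon> ^ 7) * (n * (D * (ln n)\<^sup>2))"
          using \<pi>(1) Q(4) AD l \<epsilon> by (intro mult_mono mult_right_mono) auto
        also have "\<dots> = (A * D) * (real n * ln n ^ 3 * (1 / \<epsilon> ^ 7))"
          by (simp add: power2_eq_square power3_eq_cube)
        also have "\<dots> \<le> C * (real n * ln n ^ 3 * (1 / \<epsilon> ^ 8))"
          using C pow l \<epsilon> by (intro mult_mono) auto
        finally show "real (rounds \<pi>) * (card ?P * (D * (ln n)\<^sup>2)) \<le> ?S" by simp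
      qed (use Q \<pi> n in \<open>auto simp: run_def\<close>)
      moreover have "A * ln n / \<epsilon> ^ 7 \<le> ?T"
        using C l \<epsilon> by (intro divide_right_mono mult_right_mono) auto
      moreover have "?T \<le> C * ln n / \<epsilon> ^ 8"
      proof -
        have "C * ln n * (1 / \<epsilon> ^ 7) \<le> C * ln n * (1 / \<epsilon> ^ 8)" using pow C l by (intro mult_left_mono) auto
        then show ?thesis by simp
      qed
      moreover have "D * (ln n)\<^sup>2 \<le> ?B" using C by (intro mult_right_mono) auto
      moreover have "?B \<le> ?B / \<epsilon>"
      proof -
        have "?B * 1 \<le> ?B * (1 / \<epsilon>)" using C \<epsilon> \<epsilon>1 by (intro mult_left_mono) auto
        then show ?thesis by simp
      qed
      ultimately show ?thesis by (meson mwm_protocol_mono order_trans)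
    qed
    then show "\<exists>\<pi>. mwm_protocol L R k \<epsilon> (1 / real n ^ c) ?T (C * (ln (real n))\<^sup>2 / \<epsilon>) ?S \<pi>"
      "\<exists>\<pi>. mwm_protocol L R k \<epsilon> (1 / real n ^ c) (C * ln (real n) / \<epsilon> ^ 8) ?B ?S \<pi>" by auto
  qed
qed

end
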